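(* Let $G$ be a torsion-free finitely generated nilpotent group. Then $G$ (as a structure in the language of groups) is not bi-interpretable, even with parameters, with the ring $\langle\mathbb{Z};+,\cdot,0,1\rangle$.
   Context: Interpretation with parameters: $\mathbb{A}$ is interpretable in $\mathbb{B}$ with parameters $\bar p$ if there are first-order $L(\mathbb{B})$-formulas (with parameters $\bar p$) defining a set $A^*\subseteq B^n$, an equivalence relation $\sim$ on it, and full preimages of graphs of the symbols of $L(\mathbb{A})$ on $A^*/\sim$, such that the resulting structure is isomorphic to $\mathbb{A}$ (via a surjection $\mu:A^*\to A$, the coordinate map). $\mathbb{A}$ and $\mathbb{B}$ are bi-interpretable if there are interpretations of $\mathbb{A}$ in $\mathbb{B}$ and of $\mathbb{B}$ in $\mathbb{A}$ such that, in the induced self-interpretations of $\mathbb{A}$ in $\mathbb{A}$ and of $\mathbb{B}$ in $\mathbb{B}$ (composition of codes, coordinate maps composed), the isomorphisms onto $\mathbb{A}$, resp. $\mathbb{B}$, are definable with parameters in $\mathbb{A}$, resp. $\mathbb{B}$. *)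

theory Defs
  imports "HOL-Algebra.Generated_Groups"
begin

section \<open>First-order logic over algebraic languages\<close>

text \<open>
  Languages without relation symbols suffice here: the languages of groups and of rings have
  function symbols only (constants are symbols of arity 0), besides equality.
  Variables are de Bruijn indices, and a list of elements is an assignment.
\<close>

datatype 'f trm = Var nat | App 'f "'f trm list"

datatype 'f fm = Eq "'f trm" "'f trm" | Neg "'f fm" | Conj "'f fm" "'f fm" | Exists "'f fm"

record ('f, 'a) struct =
  univ :: "'a set"
  arity :: "'f \<Rightarrow> nat"
  fn :: "'f \<Rightarrow> 'a list \<Rightarrow> 'a"

primrec wf_trm :: "('f \<Rightarrow> nat) \<Rightarrow> nat \<Rightarrow> 'f trm \<Rightarrow> bool" where
  "wf_trm ar k (Var i) \<longleftrightarrow> i < k"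
| "wf_trm ar k (App f ts) \<longleftrightarrow> length ts = ar f \<and> list_all (wf_trm ar k) ts"

text \<open>\<open>wf_fm ar k \<phi>\<close>: arities are respected and the free variables of \<open>\<phi>\<close> are among
  \<open>0, \<dots>, k - 1\<close>.\<close>

primrec wf_fm :: "('f \<Rightarrow> nat) \<Rightarrow> nat \<Rightarrow> 'f fm \<Rightarrow> bool" where
  "wf_fm ar k (Eq s t) \<longleftrightarrow> wf_trm ar k s \<and> wf_trm ar k t"
| "wf_fm ar k (Neg \<phi>) \<longleftrightarrow> wf_fm ar k \<phi>"
| "wf_fm ar k (Conj \<phi> \<psi>) \<longleftrightarrow> wf_fm ar k \<phi> \<and> wf_fm ar k \<psi>"
| "wf_fm ar k (Exists \<phi>) \<longleftrightarrow> wf_fm ar (Suc k) \<phi>"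

primrec eval_trm :: "('f, 'a) struct \<Rightarrow> 'a list \<Rightarrow> 'f trm \<Rightarrow> 'a" where
  "eval_trm M xs (Var i) = xs ! i"
| "eval_trm M xs (App f ts) = fn M f (map (eval_trm M xs) ts)"

primrec sat :: "('f, 'a) struct \<Rightarrow> 'a list \<Rightarrow> 'f fm \<Rightarrow> bool" where
  "sat M xs (Eq s t) \<longleftrightarrow> eval_trm M xs s = eval_trm M xs t"
| "sat M xs (Neg \<phi>) \<longleftrightarrow> \<not> sat M xs \<phi>"
| "sat M xs (Conj \<phi> \<psi>) \<longleftrightarrow> sat M xs \<phi> \<and> sat M xs \<psi>"
| "sat M xs (Exists \<phi>) \<longleftrightarrow> (\<exists>a\<in>univ M. sat M (a # xs) \<phi>)"

definition tuples :: "('f, 'a) struct \<Rightarrow> nat \<Rightarrow> 'a list set" where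
  "tuples M k = {xs. length xs = k \<and> set xs \<subseteq> univ M}"

definition definable_with_parameters :: "('f, 'a) struct \<Rightarrow> nat \<Rightarrow> 'a list set \<Rightarrow> bool" where
  "definable_with_parameters M k S \<longleftrightarrow>
     (\<exists>\<phi> ps. set ps \<subseteq> univ M \<and> wf_fm (arity M) (k + length ps) \<phi> \<and>
        S = {xs \<in> tuples M k. sat M (xs @ ps) \<phi>})"


section \<open>Interpretations with parameters\<close>

text \<open>
  A code for a structure with symbols \<open>'f\<close> in a structure with symbols \<open>'g\<close>: formulas for the
  domain (a set of \<open>dim\<close>-tuples), for the equivalence relation, and for the preimage of the
  graph of each symbol. All of them have the parameters as their last free variables.
\<close>

record ('f, 'g) code =
  dim :: nat
  dom_fm :: "'g fm"
  eq_fm :: "'g fm"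
  graph_fm :: "'f \<Rightarrow> 'g fm"

text \<open>\<open>wf_code A B k \<Gamma>\<close>: \<open>\<Gamma>\<close> is a code for structures in the language of \<open>A\<close> by formulas in the
  language of \<open>B\<close> with \<open>k\<close> parameters.\<close>

definition wf_code :: "('f, 'a) struct \<Rightarrow> ('g, 'b) struct \<Rightarrow> nat \<Rightarrow> ('f, 'g) code \<Rightarrow> bool" where
  "wf_code A B k \<Gamma> \<longleftrightarrow>
     wf_fm (arity B) (dim \<Gamma> + k) (dom_fm \<Gamma>) \<and>
     wf_fm (arity B) (2 * dim \<Gamma> + k) (eq_fm \<Gamma>) \<and>
     (\<forall>f. wf_fm (arity B) ((arity A f + 1) * dim \<Gamma> + k) (graph_fm \<Gamma> f))"

definition code_dom :: "('g, 'b) struct \<Rightarrow> ('f, 'g) code \<Rightarrow> 'b list \<Rightarrow> 'b list set" where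
  "code_dom B \<Gamma> ps = {xs \<in> tuples B (dim \<Gamma>). sat B (xs @ ps) (dom_fm \<Gamma>)}"

text \<open>
  The last two conjuncts say that \<open>\<mu>\<close> induces an isomorphism from the structure defined on
  \<open>code_dom B \<Gamma> ps\<close> modulo the coded relation onto \<open>A\<close>; in particular, that relation is
  an equivalence relation on \<open>code_dom B \<Gamma> ps\<close>, being the kernel of \<open>\<mu>\<close>. The values of \<open>\<mu>\<close>
  outside \<open>code_dom B \<Gamma> ps\<close> are irrelevant.
\<close>

definition interpretation_of ::
  "('f, 'a) struct \<Rightarrow> ('g, 'b) struct \<Rightarrow> ('f, 'g) code \<Rightarrow> 'b list \<Rightarrow> ('b list \<Rightarrow> 'a) \<Rightarrow> bool" where
  "interpretation_of A B \<Gamma> ps \<mu> \<longleftrightarrow>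
     set ps \<subseteq> univ B \<and> wf_code A B (length ps) \<Gamma> \<and>
     \<mu> ` code_dom B \<Gamma> ps = univ A \<and>
     (\<forall>xs \<in> code_dom B \<Gamma> ps. \<forall>ys \<in> code_dom B \<Gamma> ps.
        sat B (xs @ ys @ ps) (eq_fm \<Gamma>) \<longleftrightarrow> \<mu> xs = \<mu> ys) \<and>
     (\<forall>f xss. \<forall>ys \<in> code_dom B \<Gamma> ps. length xss = arity A f \<longrightarrow> set xss \<subseteq> code_dom B \<Gamma> ps \<longrightarrow>
        (sat B (concat xss @ ys @ ps) (graph_fm \<Gamma> f) \<longleftrightarrow> fn A f (map \<mu> xss) = \<mu> ys))"

text \<open>
  For interpretations \<open>(\<Gamma>, ps, \<mu>)\<close> of \<open>A\<close> in \<open>B\<close> and \<open>(\<Delta>, qs, \<nu>)\<close> of \<open>B\<close> in \<open>A\<close>, the induced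
  self-interpretation of \<open>A\<close> lives on the \<open>dim \<Gamma>\<close>-tuples of elements of \<open>code_dom A \<Delta> qs\<close>
  that \<open>\<nu>\<close> maps into \<open>code_dom B \<Gamma> ps\<close>, with coordinate map \<open>\<mu> \<circ> map \<nu>\<close>. The following is the
  full preimage in \<open>A\<close> of the graph of the resulting isomorphism onto \<open>A\<close>, with tuples of
  tuples flattened by \<open>concat\<close>.
\<close>

definition self_iso_graph ::
  "('f, 'a) struct \<Rightarrow> ('g, 'b) struct \<Rightarrow>
   ('f, 'g) code \<Rightarrow> 'b list \<Rightarrow> ('b list \<Rightarrow> 'a) \<Rightarrow>
   ('g, 'f) code \<Rightarrow> 'a list \<Rightarrow> ('a list \<Rightarrow> 'b) \<Rightarrow> 'a list set" where
  "self_iso_graph A B \<Gamma> ps \<mu> \<Delta> qs \<nu> =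
     {concat xss @ [\<mu> (map \<nu> xss)] | xss.
        length xss = dim \<Gamma> \<and> set xss \<subseteq> code_dom A \<Delta> qs \<and> map \<nu> xss \<in> code_dom B \<Gamma> ps}"

definition bi_interpretable :: "('f, 'a) struct \<Rightarrow> ('g, 'b) struct \<Rightarrow> bool" where
  "bi_interpretable A B \<longleftrightarrow>
     (\<exists>\<Gamma> ps \<mu> \<Delta> qs \<nu>.
        interpretation_of A B \<Gamma> ps \<mu> \<and> interpretation_of B A \<Delta> qs \<nu> \<and>
        definable_with_parameters A (dim \<Gamma> * dim \<Delta> + 1) (self_iso_graph A B \<Gamma> ps \<mu> \<Delta> qs \<nu>) \<and>
        definable_with_parameters B (dim \<Delta> * dim \<Gamma> + 1) (self_iso_graph B A \<Delta> qs \<nu> \<Gamma> ps \<mu>))"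


section \<open>Groups and the ring of integers as structures\<close>

datatype group_sym = GMult | GInv | GOne

primrec group_arity :: "group_sym \<Rightarrow> nat" where
  "group_arity GMult = 2"
| "group_arity GInv = 1"
| "group_arity GOne = 0"

primrec group_fn :: "('a, 'b) monoid_scheme \<Rightarrow> group_sym \<Rightarrow> 'a list \<Rightarrow> 'a" where
  "group_fn G GMult xs = xs ! 0 \<otimes>\<^bsub>G\<^esub> xs ! 1"
| "group_fn G GInv xs = inv\<^bsub>G\<^esub> (xs ! 0)"
| "group_fn G GOne xs = \<one>\<^bsub>G\<^esub>"

definition group_struct :: "('a, 'b) monoid_scheme \<Rightarrow> (group_sym, 'a) struct" where
  "group_struct G = \<lparr>univ = carrier G, arity = group_arity, fn = group_fn G\<rparr>"

datatype ring_sym = RPlus | RTimes | RZero | ROne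

primrec ring_arity :: "ring_sym \<Rightarrow> nat" where
  "ring_arity RPlus = 2"
| "ring_arity RTimes = 2"
| "ring_arity RZero = 0"
| "ring_arity ROne = 0"

primrec int_ring_fn :: "ring_sym \<Rightarrow> int list \<Rightarrow> int" where
  "int_ring_fn RPlus xs = xs ! 0 + xs ! 1"
| "int_ring_fn RTimes xs = xs ! 0 * xs ! 1"
| "int_ring_fn RZero xs = 0"
| "int_ring_fn ROne xs = 1"

definition int_ring_struct :: "(ring_sym, int) struct" where
  "int_ring_struct = \<lparr>univ = UNIV, arity = ring_arity, fn = int_ring_fn\<rparr>"


section \<open>Torsion-free finitely generated nilpotent groups\<close>

definition finitely_generated_group :: "('a, 'b) monoid_scheme \<Rightarrow> bool" where
  "finitely_generated_group G \<longleftrightarrow>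
     (\<exists>S. finite S \<and> S \<subseteq> carrier G \<and> generate G S = carrier G)"

definition torsion_free_group :: "('a, 'b) monoid_scheme \<Rightarrow> bool" where
  "torsion_free_group G \<longleftrightarrow>
     (\<forall>x \<in> carrier G. \<forall>n::nat. n > 0 \<longrightarrow> x [^]\<^bsub>G\<^esub> n = \<one>\<^bsub>G\<^esub> \<longrightarrow> x = \<one>\<^bsub>G\<^esub>)"

text \<open>The index is shifted: \<open>lower_central G 0 = carrier G\<close>.\<close>

primrec lower_central :: "('a, 'b) monoid_scheme \<Rightarrow> nat \<Rightarrow> 'a set" where
  "lower_central G 0 = carrier G"
| "lower_central G (Suc i) = generate G
     (\<Union>x \<in> lower_central G i. \<Union>y \<in> carrier G.
        {x \<otimes>\<^bsub>G\<^esub> y \<otimes>\<^bsub>G\<^esub> inv\<^bsub>G\<^esub> x \<otimes>\<^bsub>G\<^esub> inv\<^bsub>G\<^esub> y})"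

definition nilpotent_group :: "('a, 'b) monoid_scheme \<Rightarrow> bool" where
  "nilpotent_group G \<longleftrightarrow> (\<exists>c. lower_central G c = {\<one>\<^bsub>G\<^esub>})"

end

theory Submission
  imports Defs "HOL-Computational_Algebra.Primes" "HOL.Rat"
begin

text \<open>
  Work in an ultrapower \<open>G*\<close> of \<open>G\<close>. Choose a homomorphism \<open>\<rho>\<close> from \<open>G\<close> to its center with
  \<open>\<rho> t \<noteq> 1\<close> and a central \<open>z \<noteq> 1\<close>. If \<open>e = z^E\<close> with \<open>E\<close> nonstandard and infinitely divisible, then
  a rational functional on the image of \<open>\<rho>\<close> gives an automorphism \<open>f\<close> of \<open>G*\<close> of the form
  \<open>x \<mapsto> x e^(\<lambda>(x))\<close> that fixes all standard elements and maps \<open>g e^(-1) \<mapsto> g \<mapsto> g e\<close>, where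
  \<open>g = t^\<omega>\<close> for a nonstandard \<open>\<omega>\<close>. A bi-interpretation turns \<open>f\<close> into an automorphism \<open>\<tau>\<close> of the ring
  \<open>\<int>*\<close> which determines \<open>f\<close>, and \<open>\<tau>\<close> preserves the order, as sums of four squares show. Code
  elements of \<open>G*\<close> by tuples over \<open>\<int>*\<close> and let the size of a tuple be its sum of squares. Only finitely
  many elements of \<open>G\<close> have codes of bounded size, so \<open>E\<close> can be chosen such that all codes of
  \<open>g e\<close> and of \<open>g e^(-1)\<close> are larger than a fixed code \<open>a\<close> of \<open>g\<close>. Then \<open>\<tau>^(-1) a\<close> codes
  \<open>g e^(-1)\<close>, so it is larger than \<open>a\<close>; applying \<open>\<tau>\<close>, \<open>a\<close> is larger than \<open>\<tau> a\<close>, which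
  codes \<open>g e\<close>, a contradiction.
\<close>


section \<open>Automorphisms of ultrapowers\<close>

lemma ultrafilter_le_sequentially:
  obtains U :: "nat filter" where "U \<noteq> bot" and "U \<le> sequentially"
    and "\<And>P. eventually P U \<or> eventually (\<lambda>n. \<not> P n) U"
proof -
  \<comment> \<open>Finite intersections are required to be infinite rather than just nonempty: this
    forces every cofinite set into a maximal family, which yields
    \<open>U \<le> sequentially\<close>.\<close>
  define \<A> :: "nat set set set"
    where "\<A> = {S. \<forall>T\<subseteq>S. finite T \<longrightarrow> infinite (\<Inter>T)}"
  have "\<exists>M\<in>\<A>. \<forall>X\<in>\<A>. M \<subseteq> X \<longrightarrow> X = M"
  proof (rule subset_Zorn_nonempty)
    show "\<A> \<noteq> {}"
      by (auto simp: \<A>_def intro!: exI[of _ "{}"])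
    fix C assume C: "C \<noteq> {}" "subset.chain \<A> C"
    have "infinite (\<Inter>T)" if T: "T \<subseteq> \<Union>C" "finite T" for T
    proof -
      from finite_subset_Union_chain[OF T(2,1) C] obtain S where "S \<in> C" "T \<subseteq> S" .
      with C(2) T(2) show ?thesis
        by (auto simp: \<A>_def subset.chain_def)
    qed
    then show "\<Union>C \<in> \<A>"
      by (auto simp: \<A>_def)
  qed
  then obtain M where M: "\<And>T. T \<subseteq> M \<Longrightarrow> finite T \<Longrightarrow> infinite (\<Inter>T)"
    and max: "\<And>S. S \<in> \<A> \<Longrightarrow> M \<subseteq> S \<Longrightarrow> S = M"
    by (auto simp: \<A>_def)
  \<comment> \<open>Maximality: a set that meets every finite intersection of \<open>M\<close> in an
    infinite set can be added to \<open>M\<close>, so it is already there.\<close>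
  have in_M: "X \<in> M" if X: "\<And>T. T \<subseteq> M \<Longrightarrow> finite T \<Longrightarrow> infinite (\<Inter>T \<inter> X)" for X
  proof -
    have "insert X M \<in> \<A>"
      unfolding \<A>_def
    proof (intro CollectI allI impI)
      fix T assume T: "T \<subseteq> insert X M" "finite T"
      then have "infinite (\<Inter>(T - {X}) \<inter> X)"
        by (intro X) auto
      then show "infinite (\<Inter>T)"
        by (rule contrapos_nn) (erule rev_finite_subset, auto)
    qed
    from max[OF this] show ?thesis
      by blast
  qed
  have cofinite: "X \<in> M" if "finite (- X)" for X
  proof (rule in_M)
    fix T assume "T \<subseteq> M" "finite T"
    then have "infinite (\<Inter>T - - X)"
      using M that by (intro Diff_infinite_finite)
    then show "infinite (\<Inter>T \<inter> X)"
      by (simp add: Diff_Compl)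
  qed
  have dual: "- X \<in> M" if "X \<notin> M" for X
  proof -
    have "\<not> (\<forall>T. T \<subseteq> M \<longrightarrow> finite T \<longrightarrow> infinite (\<Inter>T \<inter> X))"
      using in_M[of X] that by auto
    then obtain T where T: "T \<subseteq> M" "finite T" "finite (\<Inter>T \<inter> X)"
      by auto
    show ?thesis
    proof (rule in_M)
      fix T' assume T': "T' \<subseteq> M" "finite T'"
      \<comment> \<open>This intersection is covered by the finite set
        \<open>\<Inter>T \<inter> X\<close> together with \<open>\<Inter>T' \<inter> - X\<close>, so
        the latter is infinite.\<close>
      then have "infinite (\<Inter>(T \<union> T'))"
        using T M[of "T \<union> T'"] by simp
      then show "infinite (\<Inter>T' \<inter> - X)"
        by (rule contrapos_nn) (erule finite_subset[OF _ finite_UnI[OF T(3)], rotated], auto)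
    qed
  qed
  \<comment> \<open>Closure under intersection and under supersets both follow from this: a failure
    would put up to three sets with empty intersection into \<open>M\<close>.\<close>
  have not_both: "\<not> (X \<in> M \<and> Y \<in> M \<and> Z \<in> M \<and> finite (X \<inter> Y \<inter> Z))" for X Y Z
    using M[of "{X, Y, Z}"] by (auto simp: Int_assoc)
  have filt: "is_filter (\<lambda>P. {n. P n} \<in> M)"
  proof
    show "{n. True} \<in> M"
      by (rule cofinite) simp
    fix P Q :: "nat \<Rightarrow> bool"
    show "{n. P n \<and> Q n} \<in> M" if PQ: "{n. P n} \<in> M" "{n. Q n} \<in> M"
    proof (rule ccontr)
      assume "{n. P n \<and> Q n} \<notin> M"
      then have "- {n. P n \<and> Q n} \<in> M"
        by (rule dual)
      moreover have "{n. P n} \<inter> {n. Q n} \<inter> - {n. P n \<and> Q n} = {}"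
        by blast
      ultimately show False
        using PQ not_both by (metis finite.emptyI)
    qed
    show "{n. Q n} \<in> M" if "\<forall>n. P n \<longrightarrow> Q n" and P: "{n. P n} \<in> M"
    proof (rule ccontr)
      assume "{n. Q n} \<notin> M"
      then have "- {n. Q n} \<in> M"
        by (rule dual)
      moreover have "{n. P n} \<inter> {n. P n} \<inter> - {n. Q n} = {}"
        using that by blast
      ultimately show False
        using P not_both by (metis finite.emptyI)
    qed
  qed
  define U where "U = Abs_filter (\<lambda>P. {n. P n} \<in> M)"
  have ev: "eventually P U \<longleftrightarrow> {n. P n} \<in> M" for P
    unfolding U_def by (rule eventually_Abs_filter[OF filt])
  show ?thesis
  proof (rule that[of U])
    show "U \<noteq> bot"
      using not_both[of "{}" "{}" "{}"] by (simp add: trivial_limit_def ev)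
    show "U \<le> sequentially"
    proof (rule filter_leI)
      fix P :: "nat \<Rightarrow> bool" assume "eventually P sequentially"
      then have "finite (- {n. P n})"
        by (auto simp: eventually_cofinite simp flip: cofinite_eq_sequentially Collect_neg_eq)
      then show "eventually P U"
        by (simp add: ev cofinite)
    qed
    show "eventually P U \<or> eventually (\<lambda>n. \<not> P n) U" for P
      using dual[of "{n. P n}"] by (auto simp: ev simp flip: Collect_neg_eq)
  qed
qed

section \<open>Tuples of sequences and transfer of truth\<close>

text \<open>A list of sequences represents a tuple over the ultrapower; \<open>slice n\<close> is
  the tuple seen at index \<open>n\<close>.\<close>

definition slice :: "nat \<Rightarrow> (nat \<Rightarrow> 'a) list \<Rightarrow> 'a list" where
  "slice n X = map (\<lambda>x. x n) X"

lemma slice_simps [simp]: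
  "slice n [] = []" "slice n (x # X) = x n # slice n X"
  "slice n (X @ Y) = slice n X @ slice n Y"
  "length (slice n X) = length X" "i < length X \<Longrightarrow> slice n X ! i = (X ! i) n"
  by (simp_all add: slice_def)

lemma slice_concat: "slice n (concat Xs) = concat (map (slice n) Xs)"
  by (simp add: slice_def[abs_def] map_concat)

lemma set_slice: "set (slice n X) = (\<lambda>x. x n) ` set X"
  by (simp add: slice_def)

lemma slice_map_const: "slice n (map (\<lambda>c _. c) ps) = ps"
  by (simp add: slice_def comp_def)

locale ultra =
  fixes U :: "nat filter"
  assumes proper: "U \<noteq> bot" and nonprincipal: "U \<le> sequentially"
    and ultra: "eventually P U \<or> eventually (\<lambda>n. \<not> P n) U"
begin

lemma eventually_neg: "eventually (\<lambda>n. \<not> P n) U \<longleftrightarrow> \<not> eventually P U"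
  using ultra[of P] proper eventually_conj[of P U "\<lambda>n. \<not> P n"] by (auto simp: trivial_limit_def)

lemma eventually_U: "eventually P sequentially \<Longrightarrow> eventually P U"
  using nonprincipal by (rule filter_leD)

lemma eventually_U_obtain:
  assumes "eventually P U"
  obtains n where "n \<ge> N" "P n"
proof -
  have "\<exists>\<^sub>F n in U. n \<ge> N \<and> P n"
    by (rule eventually_frequently[OF proper]) (intro eventually_conj assms eventually_U eventually_ge_at_top)
  then show ?thesis
    using that by (auto dest: frequently_ex)
qed

end

text \<open>Sequences stand for elements of the ultrapower of \<open>M\<close>, with equality and truth read
  \<open>U\<close>-almost everywhere; \<open>f\<close> represents an automorphism of that ultrapower.\<close>

locale ultra_automorphism = ultra U for U :: "nat filter" +
  fixes M :: "('f, 'a) struct" and f :: "(nat \<Rightarrow> 'a) \<Rightarrow> nat \<Rightarrow> 'a"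
  assumes fn_closed: "length xs = arity M s \<Longrightarrow> set xs \<subseteq> univ M \<Longrightarrow> fn M s xs \<in> univ M"
    and f_closed: "range x \<subseteq> univ M \<Longrightarrow> range (f x) \<subseteq> univ M"
    and f_eq_iff: "range x \<subseteq> univ M \<Longrightarrow> range y \<subseteq> univ M \<Longrightarrow>
      (\<forall>\<^sub>F n in U. f x n = f y n) \<longleftrightarrow> (\<forall>\<^sub>F n in U. x n = y n)"
    and f_surj: "range y \<subseteq> univ M \<Longrightarrow> \<exists>x. range x \<subseteq> univ M \<and> (\<forall>\<^sub>F n in U. f x n = y n)"
    and f_fn: "length X = arity M s \<Longrightarrow> \<forall>x\<in>set X. range x \<subseteq> univ M \<Longrightarrow>
      \<forall>\<^sub>F n in U. f (\<lambda>n. fn M s (slice n X)) n = fn M s (slice n (map f X))"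
begin

lemma eval_trm_transfer:
  assumes "wf_trm (arity M) (length X) t" and X: "\<forall>x\<in>set X. range x \<subseteq> univ M"
  shows "range (\<lambda>n. eval_trm M (slice n X) t) \<subseteq> univ M \<and>
    (\<forall>\<^sub>F n in U. f (\<lambda>n. eval_trm M (slice n X) t) n = eval_trm M (slice n (map f X)) t)"
  using assms(1)
proof (induction t)
  case (Var i)
  with X show ?case by auto
next
  case (App s ts)
  \<comment> \<open>The values of the arguments become sequences, so that \<open>f_fn\<close> covers
    a single application of \<open>s\<close>.\<close>
  define Y where "Y = map (\<lambda>t n. eval_trm M (slice n X) t) ts"
  have len: "length Y = arity M s"
    using App.prems by (simp add: Y_def)
  have IH: "range (\<lambda>n. eval_trm M (slice n X) t) \<subseteq> univ M"
    "\<forall>\<^sub>F n in U. f (\<lambda>n. eval_trm M (slice n X) t) n = eval_trm M (slice n (map f X)) t"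
    if "t \<in> set ts" for t
    using App that by (auto simp: list_all_iff)
  have Y: "\<forall>y\<in>set Y. range y \<subseteq> univ M"
    using IH(1) by (auto simp: Y_def)
  have eval: "eval_trm M (slice n X) (App s ts) = fn M s (slice n Y)" for n
    by (simp add: Y_def slice_def comp_def)
  have "fn M s (slice n Y) \<in> univ M" for n
    using len Y by (intro fn_closed) (auto simp: set_slice)
  moreover have "\<forall>\<^sub>F n in U. f (\<lambda>n. fn M s (slice n Y)) n = fn M s (slice n (map f Y))"
    using len Y by (rule f_fn)
  moreover have "\<forall>\<^sub>F n in U. \<forall>t\<in>set ts.
      f (\<lambda>n. eval_trm M (slice n X) t) n = eval_trm M (slice n (map f X)) t"
    using IH(2) by (intro eventually_ball_finite) auto
  then have "\<forall>\<^sub>F n in U. slice n (map f Y) = map (eval_trm M (slice n (map f X))) ts"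
    by eventually_elim (auto simp: Y_def slice_def)
  ultimately show ?case
    unfolding eval by (auto elim: eventually_elim2)
qed

text \<open>An automorphism preserves truth in the ultrapower, and by Los's theorem this is truth
  almost everywhere. The induction works on sequences, so no quotient is formed.\<close>

lemma sat_transfer:
  assumes "wf_fm (arity M) (length X) \<phi>" and "\<forall>x\<in>set X. range x \<subseteq> univ M"
  shows "(\<forall>\<^sub>F n in U. sat M (slice n (map f X)) \<phi>) \<longleftrightarrow> (\<forall>\<^sub>F n in U. sat M (slice n X) \<phi>)"
  using assms
proof (induction \<phi> arbitrary: X)
  case (Eq s t)
  define x y where "x = (\<lambda>n. eval_trm M (slice n X) s)" "y = (\<lambda>n. eval_trm M (slice n X) t)"
  have x: "range x \<subseteq> univ M" "\<forall>\<^sub>F n in U. f x n = eval_trm M (slice n (map f X)) s"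
    and y: "range y \<subseteq> univ M" "\<forall>\<^sub>F n in U. f y n = eval_trm M (slice n (map f X)) t"
    using Eq eval_trm_transfer[of X s] eval_trm_transfer[of X t] by (simp_all add: x_y_def)
  have "(\<forall>\<^sub>F n in U. sat M (slice n (map f X)) (Eq s t)) \<longleftrightarrow> (\<forall>\<^sub>F n in U. f x n = f y n)"
    using x(2) y(2) by (intro eventually_cong) (auto elim: eventually_elim2)
  also have "\<dots> \<longleftrightarrow> (\<forall>\<^sub>F n in U. x n = y n)"
    using x(1) y(1) by (rule f_eq_iff)
  finally show ?case
    by (simp add: x_y_def)
next
  case (Neg \<phi>)
  then show ?case by (simp add: eventually_neg)
next
  case (Conj \<phi> \<psi>)
  then show ?case by (simp add: eventually_conj_iff)
next
  case (Exists \<phi>)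
  \<comment> \<open>The quantifier step of Los's theorem: witnesses are chosen index by index, and
    nonemptiness of \<open>univ M\<close> supplies a default where there is none.\<close>
  have ex: "(\<forall>\<^sub>F n in U. sat M (slice n Y) (Exists \<phi>)) \<longleftrightarrow>
      (\<exists>x. range x \<subseteq> univ M \<and> (\<forall>\<^sub>F n in U. sat M (slice n (x # Y)) \<phi>))"
    if "length Y = length X" "\<forall>y\<in>set Y. range y \<subseteq> univ M" "univ M \<noteq> {}" for Y
  proof
    assume *: "\<forall>\<^sub>F n in U. sat M (slice n Y) (Exists \<phi>)"
    define x where "x n = (if \<exists>a\<in>univ M. sat M (a # slice n Y) \<phi>
      then SOME a. a \<in> univ M \<and> sat M (a # slice n Y) \<phi> else SOME a. a \<in> univ M)" for n
    have "x n \<in> univ M" for n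
      unfolding x_def using that(3) by (auto intro: someI2_ex simp: some_in_eq)
    moreover have "\<forall>\<^sub>F n in U. sat M (slice n (x # Y)) \<phi>"
      using * by eventually_elim (auto simp: x_def intro: someI2_ex)
    ultimately show "\<exists>x. range x \<subseteq> univ M \<and> (\<forall>\<^sub>F n in U. sat M (slice n (x # Y)) \<phi>)"
      by blast
  qed (auto elim!: eventually_mono)
  show ?case
  proof (cases "univ M = {}")
    case True
    then show ?thesis by simp
  next
    case False
    have step: "(\<forall>\<^sub>F n in U. sat M (slice n (f x # map f X)) \<phi>) \<longleftrightarrow>
        (\<forall>\<^sub>F n in U. sat M (slice n (x # X)) \<phi>)" if "range x \<subseteq> univ M" for x
      using Exists.IH[of "x # X"] Exists.prems that by simp
    \<comment> \<open>Surjectivity of \<open>f\<close> up to almost everywhere equality lets the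
      witness have the form \<open>f x\<close>.\<close>
    have surj: "(\<exists>y. range y \<subseteq> univ M \<and> (\<forall>\<^sub>F n in U. sat M (slice n (y # map f X)) \<phi>)) \<longleftrightarrow>
        (\<exists>x. range x \<subseteq> univ M \<and> (\<forall>\<^sub>F n in U. sat M (slice n (f x # map f X)) \<phi>))"
    proof
      assume "\<exists>y. range y \<subseteq> univ M \<and> (\<forall>\<^sub>F n in U. sat M (slice n (y # map f X)) \<phi>)"
      then obtain y where y: "range y \<subseteq> univ M" "\<forall>\<^sub>F n in U. sat M (slice n (y # map f X)) \<phi>"
        by blast
      from f_surj[OF y(1)] obtain x where x: "range x \<subseteq> univ M" "\<forall>\<^sub>F n in U. f x n = y n"
        by blast
      from y(2) x(2) have "\<forall>\<^sub>F n in U. sat M (slice n (f x # map f X)) \<phi>"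
        by eventually_elim simp
      with x(1) show "\<exists>x. range x \<subseteq> univ M \<and> (\<forall>\<^sub>F n in U. sat M (slice n (f x # map f X)) \<phi>)"
        by blast
    qed (use f_closed in blast)
    have "(\<forall>\<^sub>F n in U. sat M (slice n (map f X)) (Exists \<phi>)) \<longleftrightarrow>
        (\<exists>y. range y \<subseteq> univ M \<and> (\<forall>\<^sub>F n in U. sat M (slice n (y # map f X)) \<phi>))"
      using False f_closed Exists.prems(2) by (intro ex) auto
    also have "\<dots> \<longleftrightarrow> (\<exists>x. range x \<subseteq> univ M \<and> (\<forall>\<^sub>F n in U. sat M (slice n (x # X)) \<phi>))"
      unfolding surj using step by blast
    also have "\<dots> \<longleftrightarrow> (\<forall>\<^sub>F n in U. sat M (slice n X) (Exists \<phi>))"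
      using False Exists.prems(2) by (intro ex[symmetric]) auto
    finally show ?thesis .
  qed
qed

end


section \<open>Central automorphisms\<close>

text \<open>The rationals are divisible, so a functional extends from \<open>S\<close> and
  \<open>w\<close>. Concretely, take a subgroup \<open>M\<close> maximal among those that contain
  \<open>S\<close> and no power of \<open>w\<close> with nonzero exponent; modulo \<open>M\<close>,
  every \<open>b\<close> has a power with nonzero exponent that is a power of
  \<open>w\<close>.\<close>

lemma (in comm_group) rat_functional:
  assumes S: "subgroup S G" and w: "w \<in> carrier G"
    and indep: "\<And>k::int. w [^] k \<in> S \<Longrightarrow> k = 0"
  obtains \<psi> :: "'a \<Rightarrow> rat" where
    "\<And>x y. x \<in> carrier G \<Longrightarrow> y \<in> carrier G \<Longrightarrow> \<psi> (x \<otimes> y) = \<psi> x + \<psi> y"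
    "\<And>x. x \<in> S \<Longrightarrow> \<psi> x = 0" "\<psi> w = 1"
proof -
  define \<A> where "\<A> = {M. subgroup M G \<and> S \<subseteq> M \<and> (\<forall>k::int. w [^] k \<in> M \<longrightarrow> k = 0)}"
  have "\<exists>M\<in>\<A>. \<forall>X\<in>\<A>. M \<subseteq> X \<longrightarrow> X = M"
  proof (rule subset_Zorn_nonempty)
    show "\<A> \<noteq> {}"
      using S indep by (auto simp: \<A>_def)
    fix C assume C: "C \<noteq> {}" "subset.chain \<A> C"
    then have CA: "\<And>M. M \<in> C \<Longrightarrow> subgroup M G \<and> S \<subseteq> M \<and> (\<forall>k::int. w [^] k \<in> M \<longrightarrow> k = 0)"
      by (auto simp: subset.chain_def \<A>_def)
    have "subgroup (\<Union>C) G"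
    proof (rule subgroupI)
      show "\<Union>C \<subseteq> carrier G"
        using CA subgroup.subset by blast
      show "\<Union>C \<noteq> {}"
        using C(1) CA subgroup.one_closed by blast
      show "inv a \<in> \<Union>C" if "a \<in> \<Union>C" for a
        using that CA by (meson Union_iff subgroup.m_inv_closed)
      show "a \<otimes> b \<in> \<Union>C" if ab: "a \<in> \<Union>C" "b \<in> \<Union>C" for a b
      proof -
        from ab obtain M N where MN: "M \<in> C" "a \<in> M" "N \<in> C" "b \<in> N"
          by blast
        with C(2) have "M \<subseteq> N \<or> N \<subseteq> M"
          by (auto simp: subset.chain_def)
        then obtain K where "K \<in> C" "a \<in> K" "b \<in> K"
          using MN by blast
        then show ?thesis
          using CA by (meson Union_iff subgroup.m_closed)
      qed
    qed
    moreover have "S \<subseteq> \<Union>C"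
      using C(1) CA by blast
    moreover have "\<forall>k::int. w [^] k \<in> \<Union>C \<longrightarrow> k = 0"
      using CA by (meson Union_iff)
    ultimately show "\<Union>C \<in> \<A>"
      by (simp add: \<A>_def)
  qed
  then obtain M where "M \<in> \<A>" and max: "\<And>X. X \<in> \<A> \<Longrightarrow> M \<subseteq> X \<Longrightarrow> X = M"
    by blast
  then have M: "subgroup M G" "S \<subseteq> M" and indep_M: "\<And>k::int. w [^] k \<in> M \<Longrightarrow> k = 0"
    by (simp_all add: \<A>_def)
  interpret M: subgroup M G by (rule M(1))
  \<comment> \<open>\<open>R b k j\<close> says that \<open>b [^] k\<close> and
    \<open>w [^] j\<close> agree modulo \<open>M\<close>, so that \<open>\<psi> b\<close> has to be
    j / k.\<close>
  define R where "R = (\<lambda>b (k::int) (j::int). b [^] k \<otimes> w [^] (- j) \<in> M)"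
  have R_add: "R (b \<otimes> b') k (j + j')"
    if "R b k j" "R b' k j'" "b \<in> carrier G" "b' \<in> carrier G" for b b' k j j'
  proof -
    have "w [^] (- (j + j')) = w [^] (- j) \<otimes> w [^] (- j')"
      using int_pow_mult[OF w, of "- j" "- j'"] by simp
    then have "(b \<otimes> b') [^] k \<otimes> w [^] (- (j + j')) =
        (b [^] k \<otimes> w [^] (- j)) \<otimes> (b' [^] k \<otimes> w [^] (- j'))"
      using that w by (simp add: int_pow_distrib m_ac)
    with that show ?thesis
      by (simp add: R_def)
  qed
  have R_scale: "R b (k * i) (j * i)" if "R b k j" "b \<in> carrier G" for b k j i
  proof -
    have "(b [^] k \<otimes> w [^] (- j)) [^] i \<in> M"
      using that M by (simp add: R_def subgroup_int_pow_closed)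
    then show ?thesis
      using that w by (simp add: R_def int_pow_distrib int_pow_pow)
  qed
  \<comment> \<open>Well-definedness of j / k: bringing both relations to the exponent
    \<open>k * k'\<close> of \<open>b\<close> and dividing leaves a power of \<open>w\<close> in
    \<open>M\<close>, whose exponent must be 0.\<close>
  have R_unique: "j * k' = j' * k" if R: "R b k j" "R b k' j'" and b: "b \<in> carrier G"
    for b k j k' j'
  proof -
    let ?x = "b [^] (k * k')"
    have "?x \<otimes> w [^] (- (j * k')) \<in> M" "?x \<otimes> w [^] (- (j' * k)) \<in> M"
      using R_scale[OF R(1) b, of k'] R_scale[OF R(2) b, of k]
      by (simp_all add: R_def mult.commute)
    then have "inv (?x \<otimes> w [^] (- (j * k'))) \<otimes> (?x \<otimes> w [^] (- (j' * k))) \<in> M"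
      by simp
    also have "inv (?x \<otimes> w [^] (- (j * k'))) \<otimes> (?x \<otimes> w [^] (- (j' * k)))
        = w [^] (j * k') \<otimes> ((inv ?x \<otimes> ?x) \<otimes> w [^] (- (j' * k)))"
      using b w by (simp only: inv_mult_group int_pow_neg inv_inv m_assoc int_pow_closed
        inv_closed m_closed)
    also have "\<dots> = w [^] (j * k' - j' * k)"
      using b w by (simp add: int_pow_diff int_pow_neg)
    finally show ?thesis
      using indep_M by fastforce
  qed
  have R_ex: "\<exists>k j. k \<noteq> 0 \<and> R b k j" if b: "b \<in> carrier G" for b
  proof (cases "b \<in> M")
    case True
    then show ?thesis
      using b by (intro exI[of _ 1] exI[of _ 0]) (simp add: R_def)
  next
    case False
    \<comment> \<open>\<open>N\<close> is generated by \<open>M\<close> and \<open>b\<close>. It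
      exceeds \<open>M\<close>, so by maximality it contains a power of \<open>w\<close> with
      nonzero exponent.\<close>
    define N where "N = {m \<otimes> b [^] i | m i. m \<in> M \<and> (i::int) \<in> UNIV}"
    have NI: "m \<otimes> b [^] (i::int) \<in> N" if "m \<in> M" for m i
      using that by (auto simp: N_def)
    have "M \<subseteq> N"
      using NI[of _ 0] by auto
    moreover have "b \<in> N"
      using NI[of \<one> 1] b by simp
    ultimately have "N \<notin> \<A>"
      using max False by blast
    moreover have "subgroup N G"
    proof (rule subgroupI)
      show "N \<subseteq> carrier G" "N \<noteq> {}"
        using b \<open>b \<in> N\<close> by (auto simp: N_def)
      show "inv a \<in> N" if "a \<in> N" for a
      proof -
        from that obtain m i where a: "a = m \<otimes> b [^] (i::int)" "m \<in> M"
          by (auto simp: N_def)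
        with b have "inv a = inv m \<otimes> b [^] (- i)"
          by (simp add: inv_mult int_pow_neg)
        with a show ?thesis
          using NI by simp
      qed
      show "x \<otimes> y \<in> N" if "x \<in> N" "y \<in> N" for x y
      proof -
        from that obtain m i m' i' where xy: "x = m \<otimes> b [^] (i::int)" "m \<in> M"
          "y = m' \<otimes> b [^] (i'::int)" "m' \<in> M"
          by (auto simp: N_def)
        with b have "x \<otimes> y = (m \<otimes> m') \<otimes> b [^] (i + i')"
          by (simp add: int_pow_mult m_ac)
        with xy show ?thesis
          using NI by simp
      qed
    qed
    ultimately obtain j :: int where "w [^] j \<in> N" "j \<noteq> 0"
      using M(2) \<open>M \<subseteq> N\<close> by (auto simp: \<A>_def)
    then obtain m i where mi: "w [^] j = m \<otimes> b [^] (i::int)" "m \<in> M"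
      by (auto simp: N_def)
    have "i \<noteq> 0"
      using indep_M[of j] mi \<open>j \<noteq> 0\<close> by auto
    moreover have "b [^] i \<otimes> w [^] (- j) = inv m"
      using mi b w by (simp add: int_pow_neg inv_mult_group m_assoc[symmetric])
    with mi have "R b i j"
      by (simp add: R_def)
    ultimately show ?thesis by blast
  qed
  define \<psi> where "\<psi> b = (SOME r::rat. \<exists>k j. k \<noteq> 0 \<and> R b k j \<and> r = of_int j / of_int k)" for b
  have \<psi>_eq: "\<psi> b = of_int j / of_int k" if "R b k j" "k \<noteq> 0" "b \<in> carrier G" for b k j
  proof -
    have "\<exists>k j. k \<noteq> 0 \<and> R b k j \<and> \<psi> b = of_int j / of_int k"
      unfolding \<psi>_def by (rule someI_ex) (use R_ex that in blast)
    then obtain k' j' where k': "k' \<noteq> 0" "R b k' j'" "\<psi> b = of_int j' / of_int k'"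
      by blast
    have "of_int (j * k') = (of_int (j' * k) :: rat)"
      using R_unique[OF that(1) k'(2) that(3)] by simp
    with k' that show ?thesis
      by (simp add: frac_eq_eq)
  qed
  show ?thesis
  proof (rule that[of \<psi>])
    fix x y assume xy: "x \<in> carrier G" "y \<in> carrier G"
    obtain k j k' j' where k: "k \<noteq> 0" "R x k j" "k' \<noteq> 0" "R y k' j'"
      using R_ex xy by metis
    from R_scale[OF k(2) xy(1), of k'] R_scale[OF k(4) xy(2), of k]
    have "R x (k * k') (j * k')" "R y (k * k') (j' * k)"
      by (simp_all add: mult.commute)
    moreover from this have "R (x \<otimes> y) (k * k') (j * k' + j' * k)"
      using xy by (intro R_add)
    ultimately show "\<psi> (x \<otimes> y) = \<psi> x + \<psi> y"
      using xy k \<psi>_eq[of _ "k * k'"] by (simp add: add_divide_distrib)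
  next
    fix x assume "x \<in> S"
    with M(2) have "R x 1 0" "x \<in> carrier G"
      by (auto simp: R_def)
    then show "\<psi> x = 0"
      using \<psi>_eq[of x 1 0] by simp
  next
    have "R w 1 1"
      using w by (simp add: R_def int_pow_neg)
    then show "\<psi> w = 1"
      using \<psi>_eq[of w 1 1] w by simp
  qed
qed

section \<open>The center, and powers of abelian groups\<close>

definition center :: "('a, 'b) monoid_scheme \<Rightarrow> 'a set" where
  "center G = {c \<in> carrier G. \<forall>y\<in>carrier G. c \<otimes>\<^bsub>G\<^esub> y = y \<otimes>\<^bsub>G\<^esub> c}"

lemma (in group) center_carrier: "c \<in> center G \<Longrightarrow> c \<in> carrier G"
  unfolding center_def by simp

lemma (in group) center_comm: "c \<in> center G \<Longrightarrow> y \<in> carrier G \<Longrightarrow> y \<otimes> c = c \<otimes> y"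
  unfolding center_def by fastforce

lemma (in group) subgroup_center: "subgroup (center G) G"
proof (rule subgroupI)
  show "center G \<subseteq> carrier G" "center G \<noteq> {}"
    by (auto simp: center_def)
  show "inv a \<in> center G" if "a \<in> center G" for a
  proof -
    have "inv a \<otimes> y = y \<otimes> inv a" if y: "y \<in> carrier G" for y
    proof -
      have "a \<otimes> (y \<otimes> inv a) = y"
        using \<open>a \<in> center G\<close> y by (simp add: center_def m_assoc[symmetric]) (simp add: m_assoc)
      then show ?thesis
        using \<open>a \<in> center G\<close> y by (simp add: center_def inv_solve_left')
    qed
    with that show ?thesis by (auto simp: center_def)
  qed
  show "a \<otimes> b \<in> center G" if "a \<in> center G" "b \<in> center G" for a b
  proof -
    note ab = that that[THEN center_carrier]
    have "a \<otimes> b \<otimes> y = y \<otimes> (a \<otimes> b)" if y: "y \<in> carrier G" for y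
    proof -
      have "y \<otimes> (a \<otimes> b) = (y \<otimes> a) \<otimes> b"
        using ab y by (simp add: m_assoc)
      also have "\<dots> = a \<otimes> (y \<otimes> b)"
        using ab y by (simp only: center_comm[of a y] m_assoc)
      also have "\<dots> = a \<otimes> b \<otimes> y"
        using ab y by (simp only: center_comm[of b y] m_assoc)
      finally show ?thesis by simp
    qed
    with ab show ?thesis
      unfolding center_def by (intro CollectI conjI ballI m_closed)
  qed
qed

text \<open>The full countable power, not divided by the ultrafilter; sequences that agree almost
  everywhere are identified later by means of \<open>small_seqs\<close>.\<close>

definition seq_group :: "('a, 'b) monoid_scheme \<Rightarrow> (nat \<Rightarrow> 'a) monoid" where
  "seq_group H = \<lparr>carrier = {x. range x \<subseteq> carrier H},
     monoid.mult = (\<lambda>x y n. x n \<otimes>\<^bsub>H\<^esub> y n), one = (\<lambda>n. \<one>\<^bsub>H\<^esub>)\<rparr>"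

lemma seq_group_simps [simp]:
  "x \<in> carrier (seq_group H) \<longleftrightarrow> (\<forall>n. x n \<in> carrier H)"
  "x \<otimes>\<^bsub>seq_group H\<^esub> y = (\<lambda>n. x n \<otimes>\<^bsub>H\<^esub> y n)"
  "\<one>\<^bsub>seq_group H\<^esub> = (\<lambda>n. \<one>\<^bsub>H\<^esub>)"
  by (auto simp: seq_group_def)

lemma comm_group_seq_group:
  assumes "comm_group H"
  shows "comm_group (seq_group H)"
proof -
  interpret H: comm_group H by fact
  show ?thesis
  proof (rule comm_groupI)
    show "\<exists>y\<in>carrier (seq_group H). y \<otimes>\<^bsub>seq_group H\<^esub> x = \<one>\<^bsub>seq_group H\<^esub>"
      if "x \<in> carrier (seq_group H)" for x
      using that by (intro bexI[of _ "\<lambda>n. inv\<^bsub>H\<^esub> (x n)"]) simp_all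
  qed (auto simp: H.m_assoc intro!: ext H.m_comm)
qed

lemma inv_seq_group:
  assumes "comm_group H" "x \<in> carrier (seq_group H)"
  shows "inv\<^bsub>seq_group H\<^esub> x = (\<lambda>n. inv\<^bsub>H\<^esub> (x n))"
proof -
  interpret H: comm_group H by fact
  interpret S: comm_group "seq_group H" by (rule comm_group_seq_group) fact
  show ?thesis
    using assms(2) by (intro S.inv_equality) simp_all
qed

lemma int_pow_seq_group:
  assumes "comm_group H" "x \<in> carrier (seq_group H)"
  shows "x [^]\<^bsub>seq_group H\<^esub> (k::int) = (\<lambda>n. x n [^]\<^bsub>H\<^esub> k)"
proof -
  interpret H: comm_group H by fact
  interpret S: comm_group "seq_group H" by (rule comm_group_seq_group) fact
  have nat: "x [^]\<^bsub>seq_group H\<^esub> (m::nat) = (\<lambda>n. x n [^]\<^bsub>H\<^esub> m)" for m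
    by (induction m) simp_all
  have "(\<lambda>n. x n [^]\<^bsub>H\<^esub> m) \<in> carrier (seq_group H)" for m :: nat
    using assms(2) by simp
  then show ?thesis
    by (simp add: int_pow_def2 nat inv_seq_group[OF assms(1)] del: pow_nat)
qed

lemma (in group) torsion_free_int_pow_eq:
  assumes "torsion_free_group G" "x \<in> carrier G" "x \<noteq> \<one>" "x [^] (i::int) = x [^] (j::int)"
  shows "i = j"
proof (rule ccontr)
  assume "i \<noteq> j"
  have "x [^] (i - j) = \<one>" "x [^] (j - i) = \<one>"
    using assms by (simp_all add: int_pow_diff)
  then have "x [^] \<bar>i - j\<bar> = \<one>"
    by (simp add: abs_if)
  then have "x [^] (nat \<bar>i - j\<bar>) = \<one>"
    using int_pow_int[of G x "nat \<bar>i - j\<bar>"] by simp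
  moreover have "nat \<bar>i - j\<bar> > 0"
    using \<open>i \<noteq> j\<close> by simp
  ultimately show False
    using assms(1-3) by (auto simp only: torsion_free_group_def)
qed

section \<open>Nonstandard exponents and the shift automorphism\<close>

text \<open>\<open>n \<mapsto> rat_multiple E r n\<close> represents \<open>r * E\<close> once \<open>E\<close> is infinitely divisible in the
  ultrapower of \<open>\<int>\<close>.\<close>

definition rat_multiple :: "(nat \<Rightarrow> int) \<Rightarrow> rat \<Rightarrow> nat \<Rightarrow> int" where
  "rat_multiple E r n = \<lfloor>r * of_int (E n)\<rfloor>"

lemma rat_multiple_0_1 [simp]: "rat_multiple E 0 n = 0" "rat_multiple E 1 n = E n"
  by (simp_all add: rat_multiple_def)

text \<open>Once \<open>n\<close> reaches the denominator of \<open>r\<close>, that denominator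
  divides \<open>fact n\<close> and hence \<open>E n\<close>, so the floor changes nothing.\<close>

lemma rat_multiple_exact:
  assumes "\<And>n. int (fact n) dvd E n"
  shows "\<forall>\<^sub>F n in sequentially. of_int (rat_multiple E r n) = r * of_int (E n)"
proof -
  obtain p q where pq: "quotient_of r = (p, q)"
    by (cases "quotient_of r")
  then have r: "r = of_int p / of_int q" "q > 0"
    using quotient_of_div quotient_of_denom_pos by auto
  show ?thesis
    using eventually_ge_at_top[of "nat q"]
  proof eventually_elim
    case (elim n)
    have "nat q dvd fact n"
      using r(2) elim by (intro dvd_fact) auto
    then have "q dvd int (fact n)"
      using r(2) int_dvd_int_iff[of "nat q" "fact n"] by simp
    then obtain k where "E n = q * k"
      using assms[of n] by (meson dvdE dvd_trans)
    then have "r * of_int (E n) = of_int (p * k)"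
      using r by simp
    then show ?case
      by (simp only: rat_multiple_def floor_of_int)
  qed
qed

text \<open>\<open>E_dvd\<close> makes rational multiples of \<open>E\<close> exact, and
  \<open>E_ge\<close> makes \<open>E\<close> outgrow every multiple of the index. The alternative in
  \<open>\<rho>_z\<close> covers a commutator map, which kills the central \<open>z\<close>, and the
  identity of an abelian group with \<open>t = z\<close>; either way \<open>\<rho>\<close> sends the
  shifts by powers of \<open>z\<close> into \<open>small_seqs\<close>.\<close>

locale central_shift = ultra U + group G for U :: "nat filter" and G (structure) +
  fixes \<rho> :: "'a \<Rightarrow> 'a" and z t :: 'a and E :: "nat \<Rightarrow> int"
  assumes torsion_free: "torsion_free_group G"
    and \<rho>_center: "x \<in> carrier G \<Longrightarrow> \<rho> x \<in> center G"
    and \<rho>_mult: "x \<in> carrier G \<Longrightarrow> y \<in> carrier G \<Longrightarrow> \<rho> (x \<otimes> y) = \<rho> x \<otimes> \<rho> y"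
    and z: "z \<in> center G"
    and t: "t \<in> carrier G" "\<rho> t \<noteq> \<one>"
    and \<rho>_z: "\<rho> z = \<one> \<or> \<rho> z = \<rho> t"
    and E_dvd: "int (fact n) dvd E n"
    and E_ge: "(int n)\<^sup>2 \<le> E n"
begin

abbreviation "Z \<equiv> G\<lparr>carrier := center G\<rparr>"
abbreviation "e \<equiv> rat_multiple E"

lemma comm_group_Z: "comm_group Z"
proof (rule group.group_comm_groupI[OF subgroup_imp_group[OF subgroup_center]])
  fix x y assume xy: "x \<in> carrier Z" "y \<in> carrier Z"
  then have "x \<otimes> y = y \<otimes> x"
    using center_comm[of y x] center_carrier[of x] by simp
  then show "x \<otimes>\<^bsub>Z\<^esub> y = y \<otimes>\<^bsub>Z\<^esub> x"
    by simp
qed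

sublocale B: comm_group "seq_group Z"
  by (rule comm_group_seq_group[OF comm_group_Z])

lemma center_pow: "c \<in> center G \<Longrightarrow> c [^] (k::int) \<in> center G"
  by (rule subgroup_int_pow_closed[OF subgroup_center])

lemma group_hom_\<rho>: "group_hom G G \<rho>"
  by (unfold_locales) (auto simp: hom_def \<rho>_mult center_carrier \<rho>_center)

lemma \<rho>_int_pow: "x \<in> carrier G \<Longrightarrow> \<rho> (x [^] (k::int)) = \<rho> x [^] k"
  by (rule group_hom.hom_int_pow[OF group_hom_\<rho>])

lemma e_exact: "\<forall>\<^sub>F n in U. of_int (e r n) = r * of_int (E n)"
  by (rule eventually_U[OF rat_multiple_exact[OF E_dvd]])

lemma e_add: "\<forall>\<^sub>F n in U. e (r + s) n = e r n + e s n"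
  using e_exact[of r] e_exact[of s] e_exact[of "r + s"]
proof eventually_elim
  case (elim n)
  then have "of_int (e (r + s) n) = (of_int (e r n + e s n) :: rat)"
    by (simp only: of_int_add distrib_right)
  then show ?case by (simp only: of_int_eq_iff)
qed

text \<open>Represents the products of standard central elements with the rational multiples of the
  \<open>E\<close>-th power of \<open>\<rho> t\<close>. It contains all central sequences that are
  trivial almost everywhere, so a functional vanishing here respects almost everywhere
  equality.\<close>

definition small_seqs :: "(nat \<Rightarrow> 'a) set" where
  "small_seqs = {s. range s \<subseteq> center G \<and>
     (\<exists>a\<in>center G. \<exists>r. \<forall>\<^sub>F n in U. s n = a \<otimes> \<rho> t [^] e r n)}"

lemma small_seqsI:
  "range s \<subseteq> center G \<Longrightarrow> a \<in> center G \<Longrightarrow> \<forall>\<^sub>F n in U. s n = a \<otimes> \<rho> t [^] e r n \<Longrightarrow> s \<in> small_seqs"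
  by (auto simp: small_seqs_def)

lemma subgroup_small_seqs: "subgroup small_seqs (seq_group Z)"
proof -
  interpret C: subgroup "center G" G by (rule subgroup_center)
  have u: "\<rho> t \<in> carrier G" "\<rho> t \<in> center G"
    using \<rho>_center[OF t(1)] center_carrier by auto
  show ?thesis
  proof (rule B.subgroupI)
    show "small_seqs \<subseteq> carrier (seq_group Z)"
      by (auto simp: small_seqs_def image_subset_iff)
    have "(\<lambda>_. \<one>) \<in> small_seqs"
      by (rule small_seqsI[of _ \<one> 0]) auto
    then show "small_seqs \<noteq> {}" by blast
  next
    fix s assume s: "s \<in> small_seqs"
    then obtain a r where ar: "a \<in> center G" "\<forall>\<^sub>F n in U. s n = a \<otimes> \<rho> t [^] e r n"
      by (auto simp: small_seqs_def)
    have "\<forall>\<^sub>F n in U. inv s n = inv a \<otimes> \<rho> t [^] e (- r) n"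
      using ar(2) e_add[of r "- r"]
    proof eventually_elim
      case (elim n)
      then have "e (- r) n = - e r n" by simp
      with elim ar(1) u show ?case
        by (simp add: inv_mult_group int_pow_neg center_comm center_carrier)
    qed
    then have "(\<lambda>n. inv s n) \<in> small_seqs"
      using s ar(1) by (intro small_seqsI) (auto simp: small_seqs_def)
    moreover have "inv\<^bsub>seq_group Z\<^esub> s = (\<lambda>n. inv\<^bsub>Z\<^esub> s n)"
      using s by (intro inv_seq_group[OF comm_group_Z]) (auto simp: small_seqs_def)
    moreover have "inv\<^bsub>Z\<^esub> s n = inv s n" for n
      using s by (intro m_inv_consistent[OF subgroup_center]) (auto simp: small_seqs_def)
    ultimately show "inv\<^bsub>seq_group Z\<^esub> s \<in> small_seqs" by simp
  next
    fix s s' assume s: "s \<in> small_seqs" "s' \<in> small_seqs"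
    then obtain a r a' r' where ar: "a \<in> center G" "\<forall>\<^sub>F n in U. s n = a \<otimes> \<rho> t [^] e r n"
      "a' \<in> center G" "\<forall>\<^sub>F n in U. s' n = a' \<otimes> \<rho> t [^] e r' n"
      by (auto simp: small_seqs_def)
    have "\<forall>\<^sub>F n in U. s n \<otimes> s' n = (a \<otimes> a') \<otimes> \<rho> t [^] e (r + r') n"
      using ar(2) ar(4) e_add[of r r']
    proof eventually_elim
      case (elim n)
      have "a \<otimes> \<rho> t [^] e r n \<otimes> (a' \<otimes> \<rho> t [^] e r' n) =
          a \<otimes> (\<rho> t [^] e r n \<otimes> a') \<otimes> \<rho> t [^] e r' n"
        using ar u by (simp add: m_assoc center_carrier)
      also have "\<dots> = (a \<otimes> a') \<otimes> (\<rho> t [^] e r n \<otimes> \<rho> t [^] e r' n)"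
        using ar u by (simp add: center_comm[OF ar(3), of "\<rho> t [^] e r n"] m_assoc center_carrier)
      finally show ?case
        using elim u by (simp add: int_pow_mult)
    qed
    then have "(\<lambda>n. s n \<otimes> s' n) \<in> small_seqs"
      using s ar by (intro small_seqsI) (auto simp: small_seqs_def)
    then show "s \<otimes>\<^bsub>seq_group Z\<^esub> s' \<in> small_seqs" by simp
  qed
qed

text \<open>The independence needed for \<open>rat_functional\<close>. Membership makes
  \<open>int n * k - e r n\<close> constant almost everywhere; quadratic growth of \<open>E\<close>
  forces \<open>r = 0\<close>, and then \<open>int n * k\<close> can only be constant if
  \<open>k = 0\<close>.\<close>

lemma pow_seq_small:
  assumes "(\<lambda>n. (\<rho> t [^] int n) [^] (k::int)) \<in> small_seqs"
  shows "k = 0"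
proof -
  have u: "\<rho> t \<in> carrier G"
    using \<rho>_center[OF t(1)] center_carrier by auto
  from assms obtain a r where a: "a \<in> center G"
    and ev: "\<forall>\<^sub>F n in U. (\<rho> t [^] int n) [^] k = a \<otimes> \<rho> t [^] e r n"
    by (auto simp: small_seqs_def)
  have "\<forall>\<^sub>F n in U. a = \<rho> t [^] (int n * k - e r n)"
    using ev by eventually_elim
      (use a u in \<open>simp add: int_pow_diff int_pow_pow inv_solve_right center_carrier\<close>)
  \<comment> \<open>Comparison with a single index \<open>m\<close> eliminates \<open>a\<close>;
    torsion-freeness then turns equal powers of \<open>\<rho> t\<close> into equal
    exponents.\<close>
  moreover obtain m where "a = \<rho> t [^] (int m * k - e r m)"
    using eventually_U_obtain[OF calculation] by blast
  ultimately have "\<forall>\<^sub>F n in U. int n * k - e r n = int m * k - e r m"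
    by (auto elim!: eventually_mono intro: torsion_free_int_pow_eq[OF torsion_free u t(2)])
  then obtain \<alpha> where "\<forall>\<^sub>F n in U. int n * k - e r n = \<alpha>"
    by blast
  with e_exact[of r] have \<alpha>: "\<forall>\<^sub>F n in U. r * of_int (E n) = of_nat n * of_int k - of_int \<alpha>"
    by eventually_elim auto
  have "r = 0"
  proof (rule ccontr)
    assume "r \<noteq> 0"
    \<comment> \<open>For positive \<open>n\<close>, \<open>E_ge\<close> and the equation bound
      \<bar>r\<bar> * n^2 by n * (\<bar>k\<bar> + \<bar>\<alpha>\<bar>), so such an \<open>n\<close>
      cannot exceed this \<open>K\<close>.\<close>
    define K where "K = (\<bar>of_int k\<bar> + \<bar>of_int \<alpha>\<bar>) / \<bar>r\<bar>"
    obtain n where n: "n \<ge> nat \<lceil>K\<rceil> + 1" "r * of_int (E n) = of_nat n * of_int k - of_int \<alpha>"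
      using eventually_U_obtain[OF \<alpha>] by blast
    have n1: "(of_nat n :: rat) \<ge> 1" "of_nat n > K"
      using n(1) by (simp, linarith)
    have "(of_nat n :: rat)\<^sup>2 \<le> of_int (E n)"
      using E_ge[of n] by (metis of_int_le_iff of_int_of_nat_eq of_int_power)
    then have "\<bar>r\<bar> * (of_nat n)\<^sup>2 \<le> \<bar>r\<bar> * \<bar>of_int (E n)\<bar>"
      by (intro mult_left_mono) auto
    also have "\<dots> = \<bar>of_nat n * of_int k - of_int \<alpha>\<bar>"
      by (simp add: n(2) flip: abs_mult)
    also have "\<dots> \<le> \<bar>of_nat n * of_int k\<bar> + \<bar>of_int \<alpha>\<bar>"
      by (rule abs_triangle_ineq4)
    also have "\<dots> \<le> of_nat n * \<bar>of_int k\<bar> + of_nat n * \<bar>of_int \<alpha>\<bar>"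
      using n1(1) mult_right_mono[of 1 "of_nat n :: rat" "\<bar>of_int \<alpha>\<bar>"] by (simp add: abs_mult)
    also have "\<dots> = \<bar>r\<bar> * (of_nat n * K)"
      using \<open>r \<noteq> 0\<close> by (simp add: K_def field_simps)
    finally have "of_nat n * of_nat n \<le> of_nat n * K"
      using \<open>r \<noteq> 0\<close> by (simp add: power2_eq_square)
    then show False
      using n1 by simp
  qed
  with \<alpha> have \<alpha>': "\<forall>\<^sub>F n in U. int n * k = \<alpha>"
    by (auto elim!: eventually_mono) (metis of_int_eq_iff of_int_mult of_int_of_nat_eq)
  obtain n where n: "int n * k = \<alpha>"
    using eventually_U_obtain[OF \<alpha>'] by blast
  obtain n' where "n' \<ge> n + 1" "int n' * k = \<alpha>"
    using eventually_U_obtain[OF \<alpha>'] by blast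
  with n have "int n * k = int n' * k" "int n \<noteq> int n'"
    by auto
  then show ?thesis by simp
qed

lemma central_swap:
  assumes "x \<in> carrier G" "y \<in> carrier G" "c \<in> center G" "d \<in> center G"
  shows "(x \<otimes> c) \<otimes> (y \<otimes> d) = (x \<otimes> y) \<otimes> (c \<otimes> d)"
proof -
  have "(x \<otimes> c) \<otimes> (y \<otimes> d) = x \<otimes> (c \<otimes> y) \<otimes> d"
    using assms by (simp add: m_assoc center_carrier)
  also have "c \<otimes> y = y \<otimes> c"
    using assms by (simp only: center_comm)
  finally show ?thesis
    using assms by (simp add: m_assoc center_carrier)
qed

text \<open>\<open>\<Lambda>\<close> is \<open>\<rho>\<close>, applied at each index, followed by a
  functional on central sequences; \<open>\<rho>\<close> is what reduces the possibly noncommutative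
  \<open>G\<close> to an abelian group.\<close>

lemma exists_shift_functional:
  obtains \<Lambda> :: "(nat \<Rightarrow> 'a) \<Rightarrow> rat" where
    "\<And>x y. range x \<subseteq> carrier G \<Longrightarrow> range y \<subseteq> carrier G \<Longrightarrow> \<Lambda> (\<lambda>n. x n \<otimes> y n) = \<Lambda> x + \<Lambda> y"
    and "\<And>x. range x \<subseteq> carrier G \<Longrightarrow> (\<lambda>n. \<rho> (x n)) \<in> small_seqs \<Longrightarrow> \<Lambda> x = 0"
    and "\<Lambda> (\<lambda>n. t [^] int n) = 1"
proof -
  let ?w = "\<lambda>n. \<rho> t [^] int n"
  have w: "?w \<in> carrier (seq_group Z)"
    using center_pow[OF \<rho>_center[OF t(1)]] by simp
  have pow: "x [^]\<^bsub>Z\<^esub> (k::int) = x [^] k" if "x \<in> center G" for x k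
    using int_pow_consistent[OF subgroup_center that] by simp
  have indep: "k = 0" if "?w [^]\<^bsub>seq_group Z\<^esub> k \<in> small_seqs" for k :: int
  proof (rule pow_seq_small)
    have "?w [^]\<^bsub>seq_group Z\<^esub> k = (\<lambda>n. ?w n [^]\<^bsub>Z\<^esub> k)"
      by (rule int_pow_seq_group[OF comm_group_Z w])
    also have "\<dots> = (\<lambda>n. ?w n [^] k)"
      using w by (intro ext pow) simp
    finally show "(\<lambda>n. ?w n [^] k) \<in> small_seqs"
      using that by simp
  qed
  obtain \<psi> where \<psi>:
    "\<And>x y. x \<in> carrier (seq_group Z) \<Longrightarrow> y \<in> carrier (seq_group Z) \<Longrightarrow>
       \<psi> (x \<otimes>\<^bsub>seq_group Z\<^esub> y) = \<psi> x + \<psi> y"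
    "\<And>x. x \<in> small_seqs \<Longrightarrow> \<psi> x = (0 :: rat)" "\<psi> ?w = 1"
    using B.rat_functional[OF subgroup_small_seqs w indep] by blast
  show ?thesis
  proof (rule that[of "\<lambda>x. \<psi> (\<lambda>n. \<rho> (x n))"])
    fix x y :: "nat \<Rightarrow> 'a" assume xy: "range x \<subseteq> carrier G" "range y \<subseteq> carrier G"
    then have "(\<lambda>n. \<rho> (x n \<otimes> y n)) = (\<lambda>n. \<rho> (x n)) \<otimes>\<^bsub>seq_group Z\<^esub> (\<lambda>n. \<rho> (y n))"
      by (auto simp: \<rho>_mult image_subset_iff)
    moreover have "(\<lambda>n. \<rho> (x n)) \<in> carrier (seq_group Z)" "(\<lambda>n. \<rho> (y n)) \<in> carrier (seq_group Z)"
      using xy by (auto simp: \<rho>_center image_subset_iff)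
    ultimately show "\<psi> (\<lambda>n. \<rho> (x n \<otimes> y n)) = \<psi> (\<lambda>n. \<rho> (x n)) + \<psi> (\<lambda>n. \<rho> (y n))"
      by (simp only: \<psi>(1))
  next
    show "\<psi> (\<lambda>n. \<rho> (t [^] int n)) = 1"
      using \<psi>(3) by (simp only: \<rho>_int_pow[OF t(1)])
  qed (rule \<psi>(2))
qed

text \<open>Multiply \<open>x\<close> by \<open>z\<close> to the power \<Lambda>(x) * E. This is a
  homomorphism because \<open>\<Lambda>\<close> is additive and \<open>z\<close> central, and it is
  bijective because the factor does not change the value of \<open>\<Lambda>\<close>: its inverse
  uses the exponent -\<Lambda>(x) * E.\<close>

lemma exists_central_automorphism:
  obtains f where "ultra_automorphism U (group_struct G) f"
    and "\<And>c. c \<in> carrier G \<Longrightarrow> \<forall>\<^sub>F n in U. f (\<lambda>_. c) n = c"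
    and "\<forall>\<^sub>F n in U. f (\<lambda>n. t [^] int n) n = t [^] int n \<otimes> z [^] E n"
    and "\<forall>\<^sub>F n in U. f (\<lambda>n. t [^] int n \<otimes> z [^] (- E n)) n = t [^] int n"
proof -
  obtain \<Lambda> where \<Lambda>_mult: "\<And>x y. range x \<subseteq> carrier G \<Longrightarrow> range y \<subseteq> carrier G \<Longrightarrow>
      \<Lambda> (\<lambda>n. x n \<otimes> y n) = \<Lambda> x + \<Lambda> y"
    and \<Lambda>_small: "\<And>x. range x \<subseteq> carrier G \<Longrightarrow> (\<lambda>n. \<rho> (x n)) \<in> small_seqs \<Longrightarrow> \<Lambda> x = 0"
    and \<Lambda>_t: "\<Lambda> (\<lambda>n. t [^] int n) = (1 :: rat)"
    using exists_shift_functional by blast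
  define f where "f x n = x n \<otimes> z [^] e (\<Lambda> x) n" for x n
  have zc [simp]: "z \<in> carrier G"
    by (rule center_carrier[OF z])
  have uc: "\<rho> t \<in> carrier G"
    by (rule center_carrier[OF \<rho>_center[OF t(1)]])
  have \<rho>_range: "range (\<lambda>n. \<rho> (x n)) \<subseteq> center G" if "range x \<subseteq> carrier G" for x :: "nat \<Rightarrow> 'a"
    using that \<rho>_center by auto
  \<comment> \<open>\<open>\<rho>\<close> sends a standard element to a standard central one, which
    is small with \<open>r = 0\<close>; hence \<open>f\<close> fixes standard elements.\<close>
  have \<Lambda>_const: "\<Lambda> x = 0" if "\<forall>\<^sub>F n in U. x n = c" "c \<in> carrier G" "range x \<subseteq> carrier G" for x c
  proof (rule \<Lambda>_small[OF that(3)], rule small_seqsI[OF \<rho>_range[OF that(3)] \<rho>_center[OF that(2)], where r = 0])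
    show "\<forall>\<^sub>F n in U. \<rho> (x n) = \<rho> c \<otimes> \<rho> t [^] e 0 n"
      using that(1) by eventually_elim (use that \<rho>_center center_carrier in simp)
  qed
  have \<Lambda>_inv: "\<Lambda> (\<lambda>n. inv x n) = - \<Lambda> x" if x: "range x \<subseteq> carrier G" for x
  proof -
    have "\<Lambda> (\<lambda>n. x n \<otimes> inv x n) = \<Lambda> x + \<Lambda> (\<lambda>n. inv x n)"
      using x by (intro \<Lambda>_mult) auto
    moreover have "\<Lambda> (\<lambda>n. x n \<otimes> inv x n) = 0"
      using x by (intro \<Lambda>_const[of _ \<one>]) (auto simp: image_subset_iff)
    ultimately show ?thesis by simp
  qed
  \<comment> \<open>Sequences equal almost everywhere have a quotient that is almost everywhere
    trivial.\<close>
  have \<Lambda>_cong: "\<Lambda> x = \<Lambda> y"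
    if xy: "range x \<subseteq> carrier G" "range y \<subseteq> carrier G" "\<forall>\<^sub>F n in U. x n = y n" for x y
  proof -
    have "\<Lambda> (\<lambda>n. x n \<otimes> inv y n) = \<Lambda> x + - \<Lambda> y"
      using xy by (subst \<Lambda>_mult) (auto simp: \<Lambda>_inv)
    moreover have "\<Lambda> (\<lambda>n. x n \<otimes> inv y n) = 0"
    proof (rule \<Lambda>_const[of _ \<one>])
      show "\<forall>\<^sub>F n in U. x n \<otimes> inv y n = \<one>"
        using xy(3) by eventually_elim (use xy in \<open>auto simp: image_subset_iff\<close>)
    qed (use xy in \<open>auto simp: image_subset_iff\<close>)
    ultimately show ?thesis by simp
  qed
  have \<Lambda>_z: "\<Lambda> (\<lambda>n. z [^] e r n) = 0" for r
  proof (rule \<Lambda>_small)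
    have "\<rho> (z [^] e r n) = \<one> \<otimes> \<rho> t [^] e (if \<rho> z = \<one> then 0 else r) n" for n
      using \<rho>_z uc by (auto simp: \<rho>_int_pow)
    then show "(\<lambda>n. \<rho> (z [^] e r n)) \<in> small_seqs"
      by (intro small_seqsI[of _ \<one> "if \<rho> z = \<one> then 0 else r"] \<rho>_range)
        (auto simp: subgroup.one_closed[OF subgroup_center])
  qed auto
  have \<Lambda>_shift: "\<Lambda> (\<lambda>n. x n \<otimes> z [^] e r n) = \<Lambda> x" if "range x \<subseteq> carrier G" for x r
    using that by (subst \<Lambda>_mult) (auto simp: \<Lambda>_z)
  have f_closed: "range (f x) \<subseteq> carrier G" if "range x \<subseteq> carrier G" for x
    using that by (auto simp: f_def image_subset_iff)
  have \<Lambda>_f: "\<Lambda> (f x) = \<Lambda> x" if "range x \<subseteq> carrier G" for x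
    using \<Lambda>_shift[OF that] by (simp add: f_def[abs_def])
  have z_center: "z [^] (k::int) \<in> center G" for k
    by (rule center_pow[OF z])
  \<comment> \<open>Used with \<open>r = - \<Lambda> y\<close> for surjectivity and with
    \<open>r = -1\<close> for the preimage of the powers of \<open>t\<close>.\<close>
  have f_shift: "\<forall>\<^sub>F n in U. f (\<lambda>n. x n \<otimes> z [^] e r n) n = x n \<otimes> z [^] e (\<Lambda> x + r) n"
    if x: "range x \<subseteq> carrier G" for x r
    using e_add[of "\<Lambda> x" r]
  proof eventually_elim
    case (elim n)
    have "f (\<lambda>n. x n \<otimes> z [^] e r n) n = x n \<otimes> (z [^] e r n \<otimes> z [^] e (\<Lambda> x) n)"
      using x by (simp add: f_def \<Lambda>_shift m_assoc image_subset_iff)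
    then show ?case
      using elim by (simp add: int_pow_mult[symmetric] add.commute)
  qed
  have f_const: "\<forall>\<^sub>F n in U. f (\<lambda>_. c) n = c" if "c \<in> carrier G" for c
    using that \<Lambda>_const[of "\<lambda>_. c" c] by (simp add: f_def image_subset_iff)
  show ?thesis
  proof (rule that[of f])
    show "ultra_automorphism U (group_struct G) f"
    proof (unfold_locales, goal_cases)
      case (1 xs s)
      then show ?case
        by (cases s) (auto simp: group_struct_def numeral_2_eq_2 length_Suc_conv)
    next
      case (2 x)
      then show ?case
        using f_closed by (simp add: group_struct_def)
    next
      case (3 x y)
      then have xy: "range x \<subseteq> carrier G" "range y \<subseteq> carrier G"
        by (simp_all add: group_struct_def)
      show ?case
      proof
        assume eq: "\<forall>\<^sub>F n in U. f x n = f y n"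
        have "\<Lambda> x = \<Lambda> y"
          using \<Lambda>_cong[OF f_closed f_closed eq] xy \<Lambda>_f by simp
        from eq show "\<forall>\<^sub>F n in U. x n = y n"
          by eventually_elim (use xy \<open>\<Lambda> x = \<Lambda> y\<close> in \<open>auto simp: f_def image_subset_iff\<close>)
      next
        assume eq: "\<forall>\<^sub>F n in U. x n = y n"
        then have "\<Lambda> x = \<Lambda> y"
          using \<Lambda>_cong xy by blast
        with eq show "\<forall>\<^sub>F n in U. f x n = f y n"
          by (auto elim!: eventually_mono simp: f_def)
      qed
    next
      case (4 y)
      then have y: "range y \<subseteq> carrier G"
        by (simp add: group_struct_def)
      let ?x = "\<lambda>n. y n \<otimes> z [^] e (- \<Lambda> y) n"
      have "\<forall>\<^sub>F n in U. f ?x n = y n"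
        using f_shift[OF y, of "- \<Lambda> y"] y by (simp add: image_subset_iff)
      moreover have "range ?x \<subseteq> carrier G"
        using y by (auto simp: image_subset_iff)
      ultimately show ?case
        by (intro exI[of _ ?x]) (simp add: group_struct_def)
    next
      case (5 X s)
      then have X: "\<forall>x\<in>set X. range x \<subseteq> carrier G" "length X = group_arity s"
        by (simp_all add: group_struct_def)
      have "\<forall>\<^sub>F n in U. f (\<lambda>n. group_fn G s (slice n X)) n = group_fn G s (slice n (map f X))"
      proof (cases s)
        case GMult
        with X(2) obtain x y where X': "X = [x, y]"
          by (auto simp: numeral_2_eq_2 length_Suc_conv)
        with X(1) have xy: "range x \<subseteq> carrier G" "range y \<subseteq> carrier G" by auto
        have "\<forall>\<^sub>F n in U. f (\<lambda>n. x n \<otimes> y n) n = f x n \<otimes> f y n"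
          using e_add[of "\<Lambda> x" "\<Lambda> y"]
        proof eventually_elim
          case (elim n)
          have "f x n \<otimes> f y n = (x n \<otimes> y n) \<otimes> (z [^] e (\<Lambda> x) n \<otimes> z [^] e (\<Lambda> y) n)"
            unfolding f_def using xy by (intro central_swap z_center) auto
          with elim xy show ?case
            by (simp add: f_def \<Lambda>_mult int_pow_mult)
        qed
        with GMult X' show ?thesis by simp
      next
        case GInv
        with X(2) obtain x where X': "X = [x]"
          by (auto simp: numeral_2_eq_2 length_Suc_conv)
        with X(1) have x: "range x \<subseteq> carrier G" by auto
        have "\<forall>\<^sub>F n in U. f (\<lambda>n. inv x n) n = inv (f x n)"
          using e_add[of "\<Lambda> x" "- \<Lambda> x"]
        proof eventually_elim
          case (elim n)
          have "inv (f x n) = z [^] (- e (\<Lambda> x) n) \<otimes> inv x n"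
            unfolding f_def using x by (simp add: inv_mult_group int_pow_neg image_subset_iff)
          also have "\<dots> = inv x n \<otimes> z [^] (- e (\<Lambda> x) n)"
            using x by (intro center_comm[symmetric] z_center) auto
          also have "- e (\<Lambda> x) n = e (- \<Lambda> x) n"
            using elim by simp
          finally show ?case
            using x by (simp add: f_def \<Lambda>_inv)
        qed
        with GInv X' show ?thesis by simp
      next
        case GOne
        with X(2) f_const[of \<one>] show ?thesis by simp
      qed
      then show ?case
        by (simp add: group_struct_def)
    qed
  next
    show "\<forall>\<^sub>F n in U. f (\<lambda>n. t [^] int n) n = t [^] int n \<otimes> z [^] E n"
      by (simp only: f_def \<Lambda>_t rat_multiple_0_1) simp
    have tr: "range (\<lambda>n. t [^] int n) \<subseteq> carrier G"
      using t by auto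
    have "\<forall>\<^sub>F n in U. f (\<lambda>n. t [^] int n \<otimes> z [^] e (-1) n) n = t [^] int n \<otimes> z [^] e (1 + -1) n"
      using f_shift[OF tr, of "-1"] by (simp only: \<Lambda>_t)
    moreover have "e (-1) n = - E n" for n
      by (simp add: rat_multiple_def)
    ultimately show "\<forall>\<^sub>F n in U. f (\<lambda>n. t [^] int n \<otimes> z [^] (- E n)) n = t [^] int n"
      using t(1) by simp
  qed (rule f_const)
qed

end

section \<open>Central homomorphisms of nilpotent groups\<close>

lemma (in group) lower_central_subgroup: "subgroup (lower_central G i) G"
proof (induction i)
  case 0
  show ?case by (simp add: subgroup_self)
next
  case (Suc i)
  then have "lower_central G i \<subseteq> carrier G"
    by (rule subgroup.subset)
  then show ?case
    by (auto intro!: generate_is_subgroup)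
qed

lemma (in group) commutator_in_lower_central:
  assumes "x \<in> lower_central G i" "y \<in> carrier G"
  shows "x \<otimes> y \<otimes> inv x \<otimes> inv y \<in> lower_central G (Suc i)"
  using assms by (auto intro!: generate.incl)

lemma (in group) commutator_eq_one_iff:
  assumes "x \<in> carrier G" "y \<in> carrier G"
  shows "x \<otimes> y \<otimes> inv x \<otimes> inv y = \<one> \<longleftrightarrow> x \<otimes> y = y \<otimes> x"
proof -
  have "x \<otimes> y \<otimes> inv x \<otimes> inv y = (x \<otimes> y) \<otimes> inv (y \<otimes> x)"
    using assms by (simp add: inv_mult_group m_assoc)
  then show ?thesis
    using assms by (metis inv_closed inv_equality inv_inv m_closed r_inv)
qed

text \<open>The last nontrivial term of the lower central series is central. If it is all of
  \<open>G\<close>, then \<open>G\<close> is abelian and the identity serves, with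
  \<open>t = z\<close>. Otherwise take the commutator with a suitable \<open>x\<close> from the
  preceding term: its values are central, which makes it multiplicative.\<close>

lemma (in group) nilpotent_central_hom:
  assumes "nilpotent_group G" "carrier G \<noteq> {\<one>}"
  obtains \<rho> z t where "\<And>x. x \<in> carrier G \<Longrightarrow> \<rho> x \<in> center G"
    and "\<And>x y. x \<in> carrier G \<Longrightarrow> y \<in> carrier G \<Longrightarrow> \<rho> (x \<otimes> y) = \<rho> x \<otimes> \<rho> y"
    and "z \<in> center G" "z \<noteq> \<one>" "t \<in> carrier G" "\<rho> t \<noteq> \<one>" "\<rho> z = \<one> \<or> \<rho> z = \<rho> t"
proof -
  define c where "c = (LEAST c. lower_central G c = {\<one>})"
  have c: "lower_central G c = {\<one>}"
    unfolding c_def using assms(1) unfolding nilpotent_group_def by (rule LeastI_ex)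
  have "c \<noteq> 0"
  proof
    assume "c = 0"
    with c assms(2) show False by simp
  qed
  then obtain d where d: "c = Suc d"
    using not0_implies_Suc by blast
  have "lower_central G d \<noteq> {\<one>}"
    using not_less_Least[of d "\<lambda>c. lower_central G c = {\<one>}"] d by (simp add: c_def)
  moreover have "\<one> \<in> lower_central G d"
    by (rule subgroup.one_closed[OF lower_central_subgroup])
  ultimately obtain z where z: "z \<in> lower_central G d" "z \<noteq> \<one>"
    by blast
  have central: "x \<in> center G" if x: "x \<in> lower_central G d" for x
  proof -
    have xc: "x \<in> carrier G"
      using x subgroup.subset[OF lower_central_subgroup] by blast
    have "x \<otimes> y = y \<otimes> x" if "y \<in> carrier G" for y
    proof -
      have "x \<otimes> y \<otimes> inv x \<otimes> inv y \<in> lower_central G c"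
        unfolding d using x that by (rule commutator_in_lower_central)
      then show ?thesis
        using c commutator_eq_one_iff[OF xc that] by blast
    qed
    with xc show ?thesis
      unfolding center_def by blast
  qed
  show ?thesis
  proof (cases d)
    case 0
    then show ?thesis
      using z central by (intro that[of "\<lambda>x. x" z z]) auto
  next
    case (Suc k)
    define \<rho> where "\<rho> = (\<lambda>x y. x \<otimes> y \<otimes> inv x \<otimes> inv y)"
    have "\<exists>x\<in>lower_central G k. \<exists>y\<in>carrier G. \<rho> x y \<noteq> \<one>"
    proof (rule ccontr)
      assume "\<not> ?thesis"
      then have "(\<Union>x\<in>lower_central G k. \<Union>y\<in>carrier G. {x \<otimes> y \<otimes> inv x \<otimes> inv y}) \<subseteq> {\<one>}"
        by (auto simp: \<rho>_def)
      then have "lower_central G d \<subseteq> {\<one>}"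
        unfolding Suc lower_central.simps by (intro generate_subgroup_incl triv_subgroup)
      with z show False by blast
    qed
    then obtain x t where x: "x \<in> lower_central G k" and t: "t \<in> carrier G" "\<rho> x t \<noteq> \<one>"
      by blast
    have xc: "x \<in> carrier G"
      using x subgroup.subset[OF lower_central_subgroup] by blast
    have \<rho>: "\<rho> x y \<in> center G" if "y \<in> carrier G" for y
      using commutator_in_lower_central[OF x that] Suc by (intro central) (simp add: \<rho>_def)
    show ?thesis
    proof (rule that[of "\<rho> x" z t])
      fix y y' assume y: "y \<in> carrier G" "y' \<in> carrier G"
      \<comment> \<open>The commutator with \<open>y'\<close> appears inside the commutator with
        \<open>y\<close>; being central, it can be moved out to the right.\<close>
      have "\<rho> x (y \<otimes> y') = x \<otimes> y \<otimes> inv x \<otimes> (\<rho> x y' \<otimes> inv y)"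
        using xc y by (simp add: \<rho>_def inv_mult_group m_assoc inv_solve_left)
      also have "\<rho> x y' \<otimes> inv y = inv y \<otimes> \<rho> x y'"
        using y \<rho> by (intro center_comm[symmetric]) auto
      finally show "\<rho> x (y \<otimes> y') = \<rho> x y \<otimes> \<rho> x y'"
        using xc y by (simp add: \<rho>_def m_assoc)
    next
      have "x \<otimes> z = z \<otimes> x"
        using center_comm[OF central[OF z(1)] xc] .
      then show "\<rho> x z = \<one> \<or> \<rho> x z = \<rho> x t"
        using commutator_eq_one_iff[OF xc center_carrier[OF central[OF z(1)]]] by (simp add: \<rho>_def)
    qed (use \<rho> t z central in auto)
  qed
qed


section \<open>Transfer along interpretations\<close>

locale fixing_automorphism = ultra_automorphism U M f
  for U :: "nat filter" and M :: "('f, 'a) struct" and f :: "(nat \<Rightarrow> 'a) \<Rightarrow> nat \<Rightarrow> 'a" +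
  assumes f_const: "c \<in> univ M \<Longrightarrow> \<forall>\<^sub>F n in U. f (\<lambda>_. c) n = c"
begin

text \<open>Parameters enter as constant sequences, which \<open>f\<close> fixes almost everywhere,
  so they may stand unchanged on both sides.\<close>

lemma params_transfer:
  assumes "wf_fm (arity M) (length X + length ps) \<phi>" "set ps \<subseteq> univ M"
    and "\<forall>x\<in>set X. range x \<subseteq> univ M"
  shows "(\<forall>\<^sub>F n in U. sat M (slice n (map f X) @ ps) \<phi>) \<longleftrightarrow>
    (\<forall>\<^sub>F n in U. sat M (slice n X @ ps) \<phi>)"
proof -
  define P :: "(nat \<Rightarrow> 'a) list" where "P = map (\<lambda>c _. c) ps"
  have P: "slice n P = ps" for n
    by (simp add: P_def slice_map_const)
  have "\<forall>\<^sub>F n in U. \<forall>c\<in>set ps. f (\<lambda>_. c) n = c"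
    using assms(2) f_const by (intro eventually_ball_finite) auto
  then have fP: "\<forall>\<^sub>F n in U. slice n (map f P) = ps"
    by eventually_elim (simp add: P_def slice_def map_idI)
  have "(\<forall>\<^sub>F n in U. sat M (slice n (map f X) @ ps) \<phi>) \<longleftrightarrow>
      (\<forall>\<^sub>F n in U. sat M (slice n (map f (X @ P))) \<phi>)"
    using fP by (intro eventually_cong) (auto elim: eventually_mono)
  also have "\<dots> \<longleftrightarrow> (\<forall>\<^sub>F n in U. sat M (slice n (X @ P)) \<phi>)"
    using assms by (intro sat_transfer) (auto simp: P_def)
  finally show ?thesis
    by (simp add: P)
qed

lemma slice_in_tuples: "\<forall>x\<in>set X. range x \<subseteq> univ M \<Longrightarrow> slice n X \<in> tuples M (length X)"
  by (auto simp: tuples_def set_slice)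

lemma map_f_closed: "\<forall>x\<in>set X. range x \<subseteq> univ M \<Longrightarrow> \<forall>x\<in>set (map f X). range x \<subseteq> univ M"
  using f_closed by auto

lemma definable_transfer:
  assumes "definable_with_parameters M k S" "length X = k" and X: "\<forall>x\<in>set X. range x \<subseteq> univ M"
  shows "(\<forall>\<^sub>F n in U. slice n (map f X) \<in> S) \<longleftrightarrow> (\<forall>\<^sub>F n in U. slice n X \<in> S)"
proof -
  from assms(1) obtain \<phi> ps where ps: "set ps \<subseteq> univ M" "wf_fm (arity M) (k + length ps) \<phi>"
    and S: "S = {xs \<in> tuples M k. sat M (xs @ ps) \<phi>}"
    by (auto simp: definable_with_parameters_def)
  have "slice n X \<in> S \<longleftrightarrow> sat M (slice n X @ ps) \<phi>"
    "slice n (map f X) \<in> S \<longleftrightarrow> sat M (slice n (map f X) @ ps) \<phi>" for n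
    using slice_in_tuples[OF X] slice_in_tuples[OF map_f_closed[OF X]] assms(2) by (simp_all add: S)
  then show ?thesis
    using params_transfer[of X ps \<phi>] ps X assms(2) by simp
qed

end

section \<open>The automorphism induced on an interpreted structure\<close>

locale interpreted_automorphism = fixing_automorphism U M f
  for U :: "nat filter" and M :: "('f, 'a) struct" and f :: "(nat \<Rightarrow> 'a) \<Rightarrow> nat \<Rightarrow> 'a" +
  fixes B :: "('g, 'b) struct" and \<Delta> :: "('g, 'f) code" and qs :: "'a list" and \<nu> :: "'a list \<Rightarrow> 'b"
  assumes interp: "interpretation_of B M \<Delta> qs \<nu>"
    and univ_B: "univ B = UNIV"
begin

abbreviation "D \<equiv> code_dom M \<Delta> qs"

text \<open>A code is chosen at every index, not just at almost every one, which avoids side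
  conditions later.\<close>

definition coded :: "(nat \<Rightarrow> 'b) \<Rightarrow> (nat \<Rightarrow> 'a) list" where
  "coded k = (SOME X. length X = dim \<Delta> \<and> (\<forall>n. slice n X \<in> D \<and> \<nu> (slice n X) = k n))"

text \<open>Encode, apply \<open>f\<close>, decode. \<open>f\<close> keeps tuples in the code domain
  only almost everywhere; the values at the other indices do not matter.\<close>

definition induced :: "(nat \<Rightarrow> 'b) \<Rightarrow> nat \<Rightarrow> 'b" where
  "induced k n = \<nu> (slice n (map f (coded k)))"

lemma length_D: "xs \<in> D \<Longrightarrow> length xs = dim \<Delta>"
  by (simp add: code_dom_def tuples_def)

lemma D_univ: "xs \<in> D \<Longrightarrow> set xs \<subseteq> univ M"
  by (simp add: code_dom_def tuples_def)

lemma coded: "length (coded k) = dim \<Delta>" "slice n (coded k) \<in> D" "\<nu> (slice n (coded k)) = k n"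
proof -
  have "\<exists>xs\<in>D. \<nu> xs = k n" for n
  proof -
    have "k n \<in> \<nu> ` D"
      using interp univ_B by (simp add: interpretation_of_def)
    then show ?thesis by (metis imageE)
  qed
  then obtain xs where xs: "\<And>n. xs n \<in> D" "\<And>n. \<nu> (xs n) = k n"
    by metis
  define X where "X = map (\<lambda>i n. xs n ! i) [0..<dim \<Delta>]"
  have "slice n X = xs n" for n
    using length_D[OF xs(1), of n] by (auto simp: X_def slice_def comp_def intro: nth_equalityI)
  then have "length X = dim \<Delta> \<and> (\<forall>n. slice n X \<in> D \<and> \<nu> (slice n X) = k n)"
    using xs by (simp add: X_def)
  then have "length (coded k) = dim \<Delta> \<and> (\<forall>n. slice n (coded k) \<in> D \<and> \<nu> (slice n (coded k)) = k n)"
    unfolding coded_def by (rule someI)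
  then show "length (coded k) = dim \<Delta>" "slice n (coded k) \<in> D" "\<nu> (slice n (coded k)) = k n"
    by auto
qed

lemma coded_range: "\<forall>x\<in>set (coded k). range x \<subseteq> univ M"
  using D_univ[OF coded(2)] by (fastforce simp: set_slice)

lemma D_transfer:
  assumes "length X = dim \<Delta>" "\<forall>x\<in>set X. range x \<subseteq> univ M"
  shows "(\<forall>\<^sub>F n in U. slice n (map f X) \<in> D) \<longleftrightarrow> (\<forall>\<^sub>F n in U. slice n X \<in> D)"
proof (rule definable_transfer)
  show "definable_with_parameters M (dim \<Delta>) D"
    unfolding definable_with_parameters_def code_dom_def using interp
    by (intro exI[of _ "dom_fm \<Delta>"] exI[of _ qs]) (simp add: interpretation_of_def wf_code_def)
qed (use assms in auto)

lemma coded_f_D: "\<forall>\<^sub>F n in U. slice n (map f (coded k)) \<in> D"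
  using D_transfer[OF coded(1) coded_range] coded(2) by simp

text \<open>Having the same decoded value is defined by \<open>eq_fm\<close>, so it is invariant
  under \<open>f\<close>; this makes the induced map well defined and injective.\<close>

lemma eq_transfer:
  assumes X: "length X = dim \<Delta>" "\<forall>x\<in>set X. range x \<subseteq> univ M" "\<forall>\<^sub>F n in U. slice n X \<in> D"
    and Y: "length Y = dim \<Delta>" "\<forall>x\<in>set Y. range x \<subseteq> univ M" "\<forall>\<^sub>F n in U. slice n Y \<in> D"
  shows "(\<forall>\<^sub>F n in U. \<nu> (slice n (map f X)) = \<nu> (slice n (map f Y))) \<longleftrightarrow>
    (\<forall>\<^sub>F n in U. \<nu> (slice n X) = \<nu> (slice n Y))"
proof -
  have eq: "sat M (xs @ ys @ qs) (eq_fm \<Delta>) \<longleftrightarrow> \<nu> xs = \<nu> ys" if "xs \<in> D" "ys \<in> D" for xs ys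
    using interp that by (simp add: interpretation_of_def)
  have fX: "\<forall>\<^sub>F n in U. slice n (map f X) \<in> D" and fY: "\<forall>\<^sub>F n in U. slice n (map f Y) \<in> D"
    using D_transfer X Y by auto
  have "(\<forall>\<^sub>F n in U. \<nu> (slice n (map f X)) = \<nu> (slice n (map f Y))) \<longleftrightarrow>
      (\<forall>\<^sub>F n in U. sat M (slice n (map f (X @ Y)) @ qs) (eq_fm \<Delta>))"
    by (intro eventually_cong[OF eventually_conj[OF fX fY]]) (simp add: eq)
  also have "\<dots> \<longleftrightarrow> (\<forall>\<^sub>F n in U. sat M (slice n (X @ Y) @ qs) (eq_fm \<Delta>))"
    using interp X Y
    by (intro params_transfer) (auto simp: interpretation_of_def wf_code_def mult_2)
  also have "\<dots> \<longleftrightarrow> (\<forall>\<^sub>F n in U. \<nu> (slice n X) = \<nu> (slice n Y))"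
    by (intro eventually_cong[OF eventually_conj[OF X(3) Y(3)]]) (simp add: eq)
  finally show ?thesis .
qed

text \<open>Independence of the codes chosen in \<open>coded\<close>: any code serves to compute
  \<open>induced\<close>.\<close>

lemma induced_code:
  assumes "length X = dim \<Delta>" "\<forall>x\<in>set X. range x \<subseteq> univ M" "\<forall>\<^sub>F n in U. slice n X \<in> D"
    and "\<forall>\<^sub>F n in U. \<nu> (slice n X) = k n"
  shows "\<forall>\<^sub>F n in U. \<nu> (slice n (map f X)) = induced k n"
proof -
  have "\<forall>\<^sub>F n in U. \<nu> (slice n X) = \<nu> (slice n (coded k))"
    using assms(4) by (simp only: coded(3))
  then show ?thesis
    unfolding induced_def
    using eq_transfer[OF assms(1-3) coded(1) coded_range] coded(2) by simp
qed

lemma slice_concat_coded: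
  "slice n (concat (map coded K)) = concat (map (\<lambda>k. slice n (coded k)) K)"
  "slice n (map f (concat (map coded K))) = concat (map (\<lambda>k. slice n (map f (coded k))) K)"
  by (simp_all add: slice_concat map_concat comp_def)

lemma decode:
  "set (map (\<lambda>k. slice n (coded k)) K) \<subseteq> D"
  "map \<nu> (map (\<lambda>k. slice n (coded k)) K) = slice n K"
proof -
  show "set (map (\<lambda>k. slice n (coded k)) K) \<subseteq> D"
    by (simp add: image_subset_iff coded(2))
  show "map \<nu> (map (\<lambda>k. slice n (coded k)) K) = slice n K"
    unfolding slice_def[of n K] map_map comp_def coded(3) ..
qed

lemma graph_transfer:
  assumes "length K = arity B s"
  shows "\<forall>\<^sub>F n in U. induced (\<lambda>n. fn B s (slice n K)) n = fn B s (slice n (map induced K))"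
proof -
  define y where "y = (\<lambda>n. fn B s (slice n K))"
  have graph: "sat M (concat xss @ ys @ qs) (graph_fm \<Delta> s) \<longleftrightarrow> fn B s (map \<nu> xss) = \<nu> ys"
    if "length xss = arity B s" "set xss \<subseteq> D" "ys \<in> D" for xss ys
    using interp that by (simp add: interpretation_of_def)
  \<comment> \<open>Codes of the arguments followed by a code of the value: a tuple satisfying
    \<open>graph_fm\<close>, to which \<open>f\<close> is then applied.\<close>
  define W where "W = concat (map coded K) @ coded y"
  have lenW: "length W = (arity B s + 1) * dim \<Delta>"
    using assms by (simp add: W_def length_concat comp_def coded(1) sum_list_triv)
  have W: "\<forall>x\<in>set W. range x \<subseteq> univ M"
    using coded_range by (auto simp: W_def)
  have "sat M (slice n W @ qs) (graph_fm \<Delta> s)" for n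
    using graph[OF _ decode(1)[of n K] coded(2)[of n y]] assms
    by (simp add: decode(2) W_def slice_concat_coded(1) coded(3) y_def del: map_map)
  then have "\<forall>\<^sub>F n in U. sat M (slice n W @ qs) (graph_fm \<Delta> s)"
    by simp
  then have sat: "\<forall>\<^sub>F n in U. sat M (slice n (map f W) @ qs) (graph_fm \<Delta> s)"
    using params_transfer[of W qs "graph_fm \<Delta> s"] interp W lenW
    by (simp add: interpretation_of_def wf_code_def)
  have "\<forall>\<^sub>F n in U. \<forall>k\<in>set (y # K). slice n (map f (coded k)) \<in> D"
    using coded_f_D by (intro eventually_ball_finite) auto
  with sat show ?thesis
  proof eventually_elim
    case (elim n)
    have "sat M (concat (map (\<lambda>k. slice n (map f (coded k))) K) @ slice n (map f (coded y)) @ qs)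
        (graph_fm \<Delta> s)"
      using elim(1) by (simp add: W_def slice_concat_coded del: map_concat)
    then have "fn B s (map \<nu> (map (\<lambda>k. slice n (map f (coded k))) K)) = \<nu> (slice n (map f (coded y)))"
      using elim(2) assms by (subst (asm) graph) auto
    then show ?case
      by (simp add: induced_def[abs_def] slice_def comp_def y_def)
  qed
qed

text \<open>Pull a code of \<open>k\<close> back through \<open>f\<close> entry by entry. The result
  lies in the code domain almost everywhere by \<open>D_transfer\<close>, and what it decodes to is
  the preimage.\<close>

lemma induced_surj: "\<exists>l. \<forall>\<^sub>F n in U. induced l n = k n"
proof -
  have "\<forall>x\<in>set (coded k). \<exists>y. range y \<subseteq> univ M \<and> (\<forall>\<^sub>F n in U. f y n = x n)"
    using coded_range f_surj by blast
  then obtain g where g: "\<And>x. x \<in> set (coded k) \<Longrightarrow> range (g x) \<subseteq> univ M"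
    "\<And>x. x \<in> set (coded k) \<Longrightarrow> \<forall>\<^sub>F n in U. f (g x) n = x n"
    by metis
  define Y where "Y = map g (coded k)"
  have Y: "length Y = dim \<Delta>" "\<forall>x\<in>set Y. range x \<subseteq> univ M"
    using g(1) by (auto simp: Y_def coded(1))
  have "\<forall>\<^sub>F n in U. \<forall>x\<in>set (coded k). f (g x) n = x n"
    using g(2) by (intro eventually_ball_finite) auto
  then have fY: "\<forall>\<^sub>F n in U. slice n (map f Y) = slice n (coded k)"
    by eventually_elim (simp add: Y_def slice_def)
  then have "\<forall>\<^sub>F n in U. slice n (map f Y) \<in> D"
    by eventually_elim (simp only: coded(2))
  then have "\<forall>\<^sub>F n in U. slice n Y \<in> D"
    using D_transfer[OF Y] by simp
  with Y have "\<forall>\<^sub>F n in U. \<nu> (slice n (map f Y)) = induced (\<lambda>n. \<nu> (slice n Y)) n"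
    by (intro induced_code) auto
  with fY have "\<forall>\<^sub>F n in U. induced (\<lambda>n. \<nu> (slice n Y)) n = k n"
    by eventually_elim (simp add: coded(3))
  then show ?thesis by blast
qed

lemma ultra_automorphism_induced: "ultra_automorphism U B induced"
proof unfold_locales
  show "(\<forall>\<^sub>F n in U. induced x n = induced y n) \<longleftrightarrow> (\<forall>\<^sub>F n in U. x n = y n)" for x y
    unfolding induced_def using eq_transfer[OF coded(1) coded_range _ coded(1) coded_range, of x y]
    by (simp add: coded)
  show "\<exists>x. range x \<subseteq> univ B \<and> (\<forall>\<^sub>F n in U. induced x n = y n)" for y
    using induced_surj univ_B by auto
qed (use graph_transfer univ_B in auto)

text \<open>Definability of the isomorphism from the induced self-interpretation onto \<open>M\<close> says that
  \<open>f\<close> corresponds to the induced map under \<open>\<mu>\<close>.\<close>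

lemma self_iso_transfer:
  assumes def: "definable_with_parameters M (dim \<Gamma> * dim \<Delta> + 1) (self_iso_graph M B \<Gamma> ps \<mu> \<Delta> qs \<nu>)"
    and K: "length K = dim \<Gamma>" and g: "range g \<subseteq> univ M"
  shows "(\<forall>\<^sub>F n in U. slice n (map induced K) \<in> code_dom B \<Gamma> ps \<and> f g n = \<mu> (slice n (map induced K))) \<longleftrightarrow>
    (\<forall>\<^sub>F n in U. slice n K \<in> code_dom B \<Gamma> ps \<and> g n = \<mu> (slice n K))"
proof -
  let ?S = "self_iso_graph M B \<Gamma> ps \<mu> \<Delta> qs \<nu>"
  \<comment> \<open>All codes have length \<open>dim \<Delta>\<close>, so flattening loses no
    information and membership in the graph can be read off from \<open>xss\<close> itself.\<close>
  have mem: "concat xss @ [y] \<in> ?S \<longleftrightarrow> map \<nu> xss \<in> code_dom B \<Gamma> ps \<and> y = \<mu> (map \<nu> xss)"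
    if xss: "length xss = dim \<Gamma>" "set xss \<subseteq> D" for xss y
  proof
    assume "concat xss @ [y] \<in> ?S"
    then obtain yss where yss: "concat xss = concat yss" "y = \<mu> (map \<nu> yss)"
      "length yss = dim \<Gamma>" "set yss \<subseteq> D" "map \<nu> yss \<in> code_dom B \<Gamma> ps"
      by (auto simp: self_iso_graph_def)
    have "xss = yss"
    proof (rule concat_injective[OF yss(1)])
      show "length xss = length yss"
        using xss yss by simp
      show "\<forall>(x, y)\<in>set (zip xss yss). length x = length y"
      proof clarify
        fix x y assume "(x, y) \<in> set (zip xss yss)"
        then have "x \<in> D" "y \<in> D"
          by (meson subsetD xss(2) yss(4) set_zip_leftD set_zip_rightD)+
        then show "length x = length y"
          by (simp add: length_D)
      qed
    qed
    with yss show "map \<nu> xss \<in> code_dom B \<Gamma> ps \<and> y = \<mu> (map \<nu> xss)" by simp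
  qed (use xss in \<open>auto simp: self_iso_graph_def\<close>)
  define W where "W = concat (map coded K) @ [g]"
  have "length W = dim \<Gamma> * dim \<Delta> + 1"
    using K by (simp add: W_def length_concat comp_def coded(1) sum_list_triv)
  moreover have "\<forall>x\<in>set W. range x \<subseteq> univ M"
    using coded_range g by (auto simp: W_def)
  ultimately have *: "(\<forall>\<^sub>F n in U. slice n (map f W) \<in> ?S) \<longleftrightarrow> (\<forall>\<^sub>F n in U. slice n W \<in> ?S)"
    by (rule definable_transfer[OF def])
  have W: "slice n W \<in> ?S \<longleftrightarrow> slice n K \<in> code_dom B \<Gamma> ps \<and> g n = \<mu> (slice n K)" for n
    using mem[OF _ decode(1)[of n K], of "g n"] K
    by (simp add: decode(2) W_def slice_concat_coded(1) del: map_map)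
  have "\<forall>\<^sub>F n in U. \<forall>k\<in>set K. slice n (map f (coded k)) \<in> D"
    using coded_f_D by (intro eventually_ball_finite) auto
  then have fW: "\<forall>\<^sub>F n in U. slice n (map f W) \<in> ?S \<longleftrightarrow>
      slice n (map induced K) \<in> code_dom B \<Gamma> ps \<and> f g n = \<mu> (slice n (map induced K))"
  proof eventually_elim
    case (elim n)
    then show ?case
      using mem[of "map (\<lambda>k. slice n (map f (coded k))) K" "f g n"] K
      by (auto simp: W_def slice_concat_coded comp_def induced_def[abs_def] slice_def[of n "map _ K"]
        simp del: map_concat)
  qed
  show ?thesis
    using * unfolding W eventually_subst[OF fW] .
qed

end


section \<open>Automorphisms of ultrapowers of the integers\<close>

text \<open>Euler's four-square identity, the multiplicativity of the quaternion norm.\<close>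

lemma sum_four_squares_mult:
  fixes a b c d :: int
  shows "(a\<^sup>2 + b\<^sup>2 + c\<^sup>2 + d\<^sup>2) * (p\<^sup>2 + q\<^sup>2 + r\<^sup>2 + s\<^sup>2) =
    (a*p + b*q + c*r + d*s)\<^sup>2 + (a*q - b*p + c*s - d*r)\<^sup>2 +
    (a*r - b*s - c*p + d*q)\<^sup>2 + (a*s + b*r - c*q - d*p)\<^sup>2"
  by (simp add: power2_eq_square algebra_simps)

definition four_squares :: "int set" where
  "four_squares = {a\<^sup>2 + b\<^sup>2 + c\<^sup>2 + d\<^sup>2 | a b c d. True}"

lemma four_squares_mult: "x \<in> four_squares \<Longrightarrow> y \<in> four_squares \<Longrightarrow> x * y \<in> four_squares"
  unfolding four_squares_def using sum_four_squares_mult by blast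

text \<open>Pigeonhole: with p = 2 * h + 1, the numbers 0 to h have h + 1 distinct squares modulo p,
  so the residues of the squares and those of -1 minus the squares must overlap. Representatives up
  to h keep \<open>m\<close> below \<open>p\<close>.\<close>

lemma odd_prime_dvd_sum_two_squares_plus_1:
  fixes p :: int
  assumes "prime p" "odd p"
  obtains a b m where "a\<^sup>2 + b\<^sup>2 + 1 = p * m" "0 < m" "m < p"
proof -
  define h where "h = p div 2"
  have p: "p = 2 * h + 1" and h: "h > 0"
    using assms prime_gt_1_int[OF assms(1)] by (auto simp: h_def)
  define f where "f = (\<lambda>a::int. a\<^sup>2 mod p)"
  define g where "g = (\<lambda>b::int. (- 1 - b\<^sup>2) mod p)"
  have sq: "a = b" if "a \<in> {0..h}" "b \<in> {0..h}" "p dvd a\<^sup>2 - b\<^sup>2" for a b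
  proof -
    have "p dvd (a - b) * (a + b)"
      using that by (simp add: power2_eq_square algebra_simps)
    then have "p dvd a - b \<or> p dvd a + b"
      using assms(1) prime_dvd_mult_iff by blast
    moreover have "\<bar>a - b\<bar> < p" "\<bar>a + b\<bar> < p"
      using that p by auto
    ultimately have "a - b = 0 \<or> a + b = 0"
      using dvd_imp_le_int[of "a - b" p] dvd_imp_le_int[of "a + b" p] by linarith
    then show ?thesis
      using that by auto
  qed
  have "inj_on f {0..h}"
    by (rule inj_onI) (auto simp: f_def mod_eq_dvd_iff intro: sq)
  then have cf: "card (f ` {0..h}) = nat (h + 1)"
    by (simp add: card_image)
  have "inj_on g {0..h}"
  proof (rule inj_onI)
    fix x y assume xy: "x \<in> {0..h}" "y \<in> {0..h}" "g x = g y"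
    then have "p dvd (- 1 - y\<^sup>2) - (- 1 - x\<^sup>2)"
      by (metis g_def mod_eq_dvd_iff)
    with xy show "x = y" by (intro sq) (auto simp: algebra_simps)
  qed
  then have cg: "card (g ` {0..h}) = nat (h + 1)"
    by (simp add: card_image)
  have sub: "f ` {0..h} \<union> g ` {0..h} \<subseteq> {0..<p}"
    using prime_gt_0_int[OF assms(1)] by (auto simp: f_def g_def)
  have "f ` {0..h} \<inter> g ` {0..h} \<noteq> {}"
  proof
    assume "f ` {0..h} \<inter> g ` {0..h} = {}"
    then have "card (f ` {0..h} \<union> g ` {0..h}) = nat (h + 1) + nat (h + 1)"
      using cf cg by (simp add: card_Un_disjoint)
    moreover have "card (f ` {0..h} \<union> g ` {0..h}) \<le> nat p"
      using card_mono[OF _ sub] by simp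
    ultimately show False
      using p h by simp
  qed
  then obtain a b where ab: "a \<in> {0..h}" "b \<in> {0..h}" "f a = g b"
    by blast
  then have "p dvd a\<^sup>2 - (- 1 - b\<^sup>2)"
    by (simp add: f_def g_def mod_eq_dvd_iff)
  then obtain m where m: "a\<^sup>2 + b\<^sup>2 + 1 = p * m"
    by (auto simp: dvd_def algebra_simps)
  have "p * m > 0"
    using m by (smt (verit) zero_le_power2)
  then have "m > 0"
    using p h by (simp add: zero_less_mult_iff)
  have "a\<^sup>2 \<le> h\<^sup>2" "b\<^sup>2 \<le> h\<^sup>2"
    using ab by (auto intro: power_mono)
  then have "p * m \<le> 2 * h\<^sup>2 + 1"
    using m by linarith
  also have "\<dots> < p * p"
    using h p by (simp add: power2_eq_square algebra_simps add_pos_pos)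
  finally have "m < p"
    by (rule mult_left_less_imp_less) (use p h in simp)
  from this m \<open>m > 0\<close> show ?thesis
    using that by blast
qed

text \<open>Allowing a ratio of sums of four squares replaces Lagrange's descent by an induction
  on the size of the prime.\<close>

lemma pos_times_four_squares:
  fixes x :: int
  assumes "x > 0"
  shows "\<exists>s\<in>four_squares. \<exists>s'\<in>four_squares. s \<noteq> 0 \<and> x * s = s'"
proof -
  let ?Q = "\<lambda>x::int. \<exists>s\<in>four_squares. \<exists>s'\<in>four_squares. s \<noteq> 0 \<and> x * s = s'"
  have sum4: "a\<^sup>2 + b\<^sup>2 + c\<^sup>2 + d\<^sup>2 \<in> four_squares" for a b c d
    by (auto simp: four_squares_def)
  have small: "1 \<in> four_squares" "2 \<in> four_squares"
    using sum4[of 1 0 0 0] sum4[of 1 1 0 0] by simp_all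
  then have one: "?Q 1"
    by (intro bexI[of _ 1]) simp_all
  have mult: "?Q (x * y)" if "?Q x" "?Q y" for x y
  proof -
    from that obtain s t where "s \<in> four_squares" "x * s \<in> four_squares" "s \<noteq> 0"
      "t \<in> four_squares" "y * t \<in> four_squares" "t \<noteq> 0" by blast
    moreover have "x * y * (s * t) = (x * s) * (y * t)" by simp
    ultimately show ?thesis
      by (metis four_squares_mult mult_eq_0_iff)
  qed
  \<comment> \<open>For odd \<open>p\<close>, let \<open>p * m\<close> be a sum of four squares with
    \<open>m < p\<close>. If \<open>s\<close> witnesses the claim for \<open>m\<close>, then
    \<open>m * s\<close> witnesses it for \<open>p\<close>, since p * (m * s) = (p * m) * s.\<close>
  have prime: "?Q p" if "prime p" and less: "\<And>y. 0 < y \<Longrightarrow> y < p \<Longrightarrow> ?Q y" for p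
  proof (cases "p = 2")
    case True
    then show ?thesis
      using small by (intro bexI[of _ 1] bexI[of _ 2]) simp_all
  next
    case False
    with \<open>prime p\<close> have "odd p"
      using prime_odd_int[of p] prime_ge_2_int[of p] by force
    with \<open>prime p\<close> obtain a b m where m: "a\<^sup>2 + b\<^sup>2 + 1 = p * m" "0 < m" "m < p"
      by (rule odd_prime_dvd_sum_two_squares_plus_1)
    with less obtain s where s: "s \<in> four_squares" "m * s \<in> four_squares" "s \<noteq> 0"
      by blast
    have "p * m \<in> four_squares"
      using sum4[of a b 1 0] m(1) by simp
    then have "p * (m * s) \<in> four_squares"
      using s four_squares_mult by (metis mult.assoc)
    with s m show ?thesis
      by (metis mult_eq_0_iff less_irrefl)
  qed
  have "0 < x \<longrightarrow> ?Q x"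
  proof (induction "nat x" arbitrary: x rule: less_induct)
    case less
    show ?case
    proof (intro impI)
      assume x: "0 < x"
      show "?Q x"
      proof (cases "x = 1")
        case False
        with x obtain p where p: "prime p" "p dvd x"
          by (metis prime_factor_int abs_of_pos)
        then obtain y where y: "x = p * y" by blast
        have p1: "p > 1" using p prime_gt_1_int by blast
        with x y have y0: "y > 0" by (simp add: zero_less_mult_iff)
        with p1 y have yx: "y < x" by simp
        have px: "p \<le> x" using p x by (simp add: zdvd_imp_le)
        have "?Q p" using p(1)
          by (rule prime) (use less px x in auto)
        moreover have "?Q y"
          using less y0 yx by auto
        ultimately show ?thesis using mult y by simp
      qed (use one in simp)
    qed
  qed
  with assms show ?thesis by blast
qed

section \<open>Preservation of order and size\<close>

locale int_automorphism = ultra_automorphism U int_ring_struct f for U f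
begin

lemma f_plus: "\<forall>\<^sub>F n in U. f (\<lambda>n. x n + y n) n = f x n + f y n"
  using f_fn[of "[x, y]" RPlus] by (simp add: int_ring_struct_def)

lemma f_times: "\<forall>\<^sub>F n in U. f (\<lambda>n. x n * y n) n = f x n * f y n"
  using f_fn[of "[x, y]" RTimes] by (simp add: int_ring_struct_def)

lemma f_zero: "\<forall>\<^sub>F n in U. f (\<lambda>n. 0) n = 0"
  using f_fn[of "[]" RZero] by (simp add: int_ring_struct_def)

lemma f_cong: "\<forall>\<^sub>F n in U. x n = y n \<Longrightarrow> \<forall>\<^sub>F n in U. f x n = f y n"
  using f_eq_iff[of x y] by (simp add: int_ring_struct_def)

lemma f_nonzero:
  assumes "\<forall>\<^sub>F n in U. x n \<noteq> 0"
  shows "\<forall>\<^sub>F n in U. f x n \<noteq> 0"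
proof -
  have "\<not> (\<forall>\<^sub>F n in U. f x n = f (\<lambda>n. 0) n)"
    using assms f_eq_iff[of x "\<lambda>n. 0"] by (simp add: int_ring_struct_def eventually_neg)
  then have "\<forall>\<^sub>F n in U. f x n \<noteq> f (\<lambda>n. 0) n"
    by (simp add: eventually_neg)
  with f_zero show ?thesis
    by eventually_elim simp
qed

lemma f_four_squares:
  "\<forall>\<^sub>F n in U. f (\<lambda>n. a n * a n + b n * b n + c n * c n + d n * d n) n =
    f a n * f a n + f b n * f b n + f c n * f c n + f d n * f d n"
  using f_plus[of "\<lambda>n. a n * a n + b n * b n + c n * c n" "\<lambda>n. d n * d n"]
    f_plus[of "\<lambda>n. a n * a n + b n * b n" "\<lambda>n. c n * c n"]
    f_plus[of "\<lambda>n. a n * a n" "\<lambda>n. b n * b n"]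
    f_times[of a a] f_times[of b b] f_times[of c c] f_times[of d d]
  by eventually_elim simp

text \<open>A nonzero integer is positive iff some nonzero sum of four squares times it is a sum of
  four squares. This condition uses only the ring operations, so an automorphism preserves
  it.\<close>

lemma f_pos:
  assumes "\<forall>\<^sub>F n in U. x n > 0"
  shows "\<forall>\<^sub>F n in U. f x n > 0"
proof -
  \<comment> \<open>The implication makes the choice of witnesses possible at every index, including
    those where \<open>x n\<close> is not positive.\<close>
  have "\<exists>a b c d p q r s. x n > 0 \<longrightarrow> a * a + b * b + c * c + d * d \<noteq> 0 \<and>
      x n * (a * a + b * b + c * c + d * d) = p * p + q * q + r * r + s * s" for n
  proof (cases "x n > 0")
    case True
    from pos_times_four_squares[OF this] show ?thesis
      by (fastforce simp: four_squares_def power2_eq_square)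
  qed simp
  then obtain a b c d p q r s where
    sq: "\<And>n. x n > 0 \<longrightarrow> a n * a n + b n * b n + c n * c n + d n * d n \<noteq> 0 \<and>
      x n * (a n * a n + b n * b n + c n * c n + d n * d n) =
      p n * p n + q n * q n + r n * r n + s n * s n"
    by metis
  define y y' where "y = (\<lambda>n. a n * a n + b n * b n + c n * c n + d n * d n)"
    and "y' = (\<lambda>n. p n * p n + q n * q n + r n * r n + s n * s n)"
  have "\<forall>\<^sub>F n in U. y n \<noteq> 0" "\<forall>\<^sub>F n in U. x n * y n = y' n" "\<forall>\<^sub>F n in U. x n \<noteq> 0"
    using assms sq by (auto elim!: eventually_mono simp: y_def y'_def)
  then have "\<forall>\<^sub>F n in U. f y n \<noteq> 0" "\<forall>\<^sub>F n in U. f (\<lambda>n. x n * y n) n = f y' n" "\<forall>\<^sub>F n in U. f x n \<noteq> 0"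
    by (auto intro: f_nonzero f_cong)
  then show ?thesis
    using f_times[of x y] f_four_squares[of a b c d] f_four_squares[of p q r s]
  proof eventually_elim
    case (elim n)
    have "f y n \<ge> 0" "f y' n \<ge> 0"
      using elim(5,6) by (simp_all add: y_def y'_def)
    moreover have "f x n * f y n = f y' n"
      using elim(2,4) by simp
    ultimately have "f x n \<ge> 0"
      using elim(1) by (metis mult_less_0_iff not_less order_le_less)
    with elim(3) show ?case by simp
  qed
qed

lemma f_less:
  assumes "\<forall>\<^sub>F n in U. x n < y n"
  shows "\<forall>\<^sub>F n in U. f x n < f y n"
proof -
  define d where "d = (\<lambda>n. y n - x n)"
  have "\<forall>\<^sub>F n in U. f d n > 0"
    using assms by (intro f_pos) (auto elim!: eventually_mono simp: d_def)
  moreover have "\<forall>\<^sub>F n in U. f (\<lambda>n. x n + d n) n = f x n + f d n"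
    by (rule f_plus)
  moreover have "(\<lambda>n. x n + d n) = y"
    by (simp add: d_def)
  ultimately show ?thesis
    by (auto elim: eventually_elim2)
qed

lemma f_sum_squares:
  "\<forall>\<^sub>F n in U. f (\<lambda>n. \<Sum>x\<leftarrow>slice n K. x * x) n = (\<Sum>x\<leftarrow>slice n (map f K). x * x)"
proof (induction K)
  case Nil
  show ?case using f_zero by simp
next
  case (Cons k K)
  with f_plus[of "\<lambda>n. k n * k n" "\<lambda>n. \<Sum>x\<leftarrow>slice n K. x * x"] f_times[of k k] show ?case
    by eventually_elim simp
qed

end


section \<open>Growth of codes\<close>

text \<open>For integers \<bar>x\<bar> \<le> x * x, so a bound on the sum bounds every
  entry.\<close>

lemma finite_lists_sum_squares_le:
  "finite {xs :: int list. length xs = d \<and> (\<Sum>x\<leftarrow>xs. x * x) \<le> N}"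
proof (rule finite_subset)
  show "{xs. length xs = d \<and> (\<Sum>x\<leftarrow>xs. x * x) \<le> N} \<subseteq> {xs. set xs \<subseteq> {- N..N} \<and> length xs = d}"
  proof (intro subsetI CollectI conjI)
    fix xs x assume xs: "xs \<in> {xs. length xs = d \<and> (\<Sum>x\<leftarrow>xs. x * x) \<le> N}"
    then show "length xs = d" by simp
    from xs have le: "(\<Sum>x\<leftarrow>xs. x * x) \<le> N" by simp
    assume "x \<in> set xs"
    then have "x * x \<le> (\<Sum>x\<leftarrow>xs. x * x)"
      by (intro member_le_sum_list) auto
    with le have "\<bar>x\<bar> * \<bar>x\<bar> \<le> N"
      by (simp flip: abs_mult)
    moreover have "\<bar>x\<bar> \<le> \<bar>x\<bar> * \<bar>x\<bar>"
      using mult_right_mono[of 1 "\<bar>x\<bar>" "\<bar>x\<bar>"] by (cases "x = 0") simp_all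
    ultimately show "x \<in> {- N..N}" by auto
  qed
qed (rule finite_lists_length_eq, simp)

text \<open>The powers of \<open>z\<close> are distinct, so among the multiples of \<open>m\<close>
  only finitely many exponents of either sign lead into \<open>F\<close>.\<close>

lemma (in group) exists_exponent_avoiding:
  assumes tf: "torsion_free_group G" and z: "z \<in> carrier G" "z \<noteq> \<one>" and x: "x \<in> carrier G"
    and F: "finite F" and m: "(m::int) > 0"
  obtains E :: int where "m dvd E" "N \<le> E" "x \<otimes> z [^] E \<notin> F" "x \<otimes> z [^] (- E) \<notin> F"
proof -
  have inj: "inj (\<lambda>j::nat. x \<otimes> z [^] (s * m * int j))" if "s \<noteq> 0" for s :: int
  proof (rule injI)
    fix i j assume "x \<otimes> z [^] (s * m * int i) = x \<otimes> z [^] (s * m * int j)"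
    then have "s * m * int i = s * m * int j"
      using x z by (intro torsion_free_int_pow_eq[OF tf z]) simp
    then show "i = j" using m that by simp
  qed
  have "finite ((\<lambda>j. x \<otimes> z [^] (1 * m * int j)) -` F \<union> (\<lambda>j. x \<otimes> z [^] (-1 * m * int j)) -` F \<union> {..<nat N})"
    using finite_vimageI[OF F inj[of 1]] finite_vimageI[OF F inj[of "-1"]] by simp
  from ex_new_if_finite[OF infinite_UNIV_nat this]
  obtain j where j: "x \<otimes> z [^] (1 * m * int j) \<notin> F" "x \<otimes> z [^] (-1 * m * int j) \<notin> F" "nat N \<le> j"
    by auto
  have "int j \<le> m * int j"
    using m by (simp add: mult_le_cancel_right1)
  with j show ?thesis
    by (intro that[of "m * int j"]) auto
qed

section \<open>The contradiction between the shift automorphism and the order\<close>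

theorem theorem12p4:
  fixes G :: "('a, 'b) monoid_scheme"
  assumes "group G"
    and "torsion_free_group G"
    and "finitely_generated_group G"
    and "nilpotent_group G"
  shows "\<not> bi_interpretable (group_struct G) int_ring_struct"
proof
  let ?A = "group_struct G" and ?B = int_ring_struct
  assume "bi_interpretable ?A ?B"
  then obtain \<Gamma> ps \<mu> \<Delta> qs \<nu> where \<Gamma>: "interpretation_of ?A ?B \<Gamma> ps \<mu>"
    and \<Delta>: "interpretation_of ?B ?A \<Delta> qs \<nu>"
    and def: "definable_with_parameters ?A (dim \<Gamma> * dim \<Delta> + 1) (self_iso_graph ?A ?B \<Gamma> ps \<mu> \<Delta> qs \<nu>)"
    by (auto simp: bi_interpretable_def)
  interpret group G by fact
  have univ: "univ ?A = carrier G" "univ ?B = UNIV"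
    by (simp_all add: group_struct_def int_ring_struct_def)
  \<comment> \<open>A trivial group has only finitely many tuples of given length, too few to code
    all integers.\<close>
  have nontrivial: "carrier G \<noteq> {\<one>\<^bsub>G\<^esub>}"
  proof
    assume "carrier G = {\<one>\<^bsub>G\<^esub>}"
    then have "code_dom ?A \<Delta> qs \<subseteq> {xs. set xs \<subseteq> {\<one>\<^bsub>G\<^esub>} \<and> length xs = dim \<Delta>}"
      by (auto simp: code_dom_def tuples_def univ)
    then have "finite (\<nu> ` code_dom ?A \<Delta> qs)"
      by (intro finite_imageI) (rule finite_subset, auto intro: finite_lists_length_eq)
    moreover have "\<nu> ` code_dom ?A \<Delta> qs = UNIV"
      using \<Delta> by (simp add: interpretation_of_def univ)
    ultimately show False
      using infinite_UNIV_int by simp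
  qed
  obtain \<rho> z t where \<rho>: "\<And>x. x \<in> carrier G \<Longrightarrow> \<rho> x \<in> center G"
      "\<And>x y. x \<in> carrier G \<Longrightarrow> y \<in> carrier G \<Longrightarrow> \<rho> (x \<otimes>\<^bsub>G\<^esub> y) = \<rho> x \<otimes>\<^bsub>G\<^esub> \<rho> y"
    and z: "z \<in> center G" "z \<noteq> \<one>\<^bsub>G\<^esub>"
    and t: "t \<in> carrier G" "\<rho> t \<noteq> \<one>\<^bsub>G\<^esub>" "\<rho> z = \<one>\<^bsub>G\<^esub> \<or> \<rho> z = \<rho> t"
    using nilpotent_central_hom[OF assms(4) nontrivial] by blast
  obtain U :: "nat filter" where U: "U \<noteq> bot" "U \<le> sequentially"
    "\<And>P. eventually P U \<or> eventually (\<lambda>n. \<not> P n) U"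
    by (rule ultrafilter_le_sequentially) (rule that)
  interpret ultra U
    by unfold_locales (rule U)+
  define T where "T = (\<lambda>n. t [^]\<^bsub>G\<^esub> int n)"
  have T: "T n \<in> carrier G" for n
    using t(1) by (simp add: T_def)
  have zc: "z \<in> carrier G"
    by (rule center_carrier[OF z(1)])

  have "\<exists>xs\<in>code_dom ?B \<Gamma> ps. \<mu> xs = T n" for n
  proof -
    have "T n \<in> \<mu> ` code_dom ?B \<Gamma> ps"
      using \<Gamma> T by (simp add: interpretation_of_def univ)
    then show ?thesis by (metis imageE)
  qed
  \<comment> \<open>At index \<open>n\<close> this is the fixed code \<open>a\<close> of g from the
    outline.\<close>
  then obtain as where as: "\<And>n. as n \<in> code_dom ?B \<Gamma> ps" "\<And>n. \<mu> (as n) = T n"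
    by metis
  define sq :: "int list \<Rightarrow> int" where "sq = (\<lambda>xs. \<Sum>x\<leftarrow>xs. x * x)"
  \<comment> \<open>All values at tuples no larger than \<open>as n\<close>, whether or not these
    are codes; only finiteness is needed.\<close>
  define F where "F = (\<lambda>n. \<mu> ` {xs. length xs = dim \<Gamma> \<and> sq xs \<le> sq (as n)})"
  have "\<exists>E::int. int (fact n) dvd E \<and> (int n)\<^sup>2 \<le> E \<and>
      T n \<otimes>\<^bsub>G\<^esub> z [^]\<^bsub>G\<^esub> E \<notin> F n \<and> T n \<otimes>\<^bsub>G\<^esub> z [^]\<^bsub>G\<^esub> (- E) \<notin> F n" for n
  proof -
    have "finite (F n)"
      unfolding F_def sq_def by (intro finite_imageI finite_lists_sum_squares_le)
    then show ?thesis
      using exists_exponent_avoiding[OF assms(2) zc z(2) T[of n], of "F n" "int (fact n)" "(int n)\<^sup>2"]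
      by (metis of_nat_0_less_iff fact_gt_zero)
  qed
  then obtain E :: "nat \<Rightarrow> int" where E: "\<And>n. int (fact n) dvd E n" "\<And>n. (int n)\<^sup>2 \<le> E n"
    "\<And>n. T n \<otimes>\<^bsub>G\<^esub> z [^]\<^bsub>G\<^esub> E n \<notin> F n" "\<And>n. T n \<otimes>\<^bsub>G\<^esub> z [^]\<^bsub>G\<^esub> (- E n) \<notin> F n"
    by metis
  have larger: "sq (as n) < sq xs"
    if "xs \<in> code_dom ?B \<Gamma> ps" "\<mu> xs = T n \<otimes>\<^bsub>G\<^esub> z [^]\<^bsub>G\<^esub> E n \<or> \<mu> xs = T n \<otimes>\<^bsub>G\<^esub> z [^]\<^bsub>G\<^esub> (- E n)"
    for xs n
    using that E(3,4)[of n] by (force simp: F_def code_dom_def tuples_def not_le[symmetric])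

  interpret central_shift U G \<rho> z t E
    by unfold_locales (rule assms(2) \<rho> z t E | assumption)+
  obtain f where f: "ultra_automorphism U ?A f"
    and f_const: "\<And>c. c \<in> carrier G \<Longrightarrow> \<forall>\<^sub>F n in U. f (\<lambda>_. c) n = c"
    and f_T: "\<forall>\<^sub>F n in U. f T n = T n \<otimes>\<^bsub>G\<^esub> z [^]\<^bsub>G\<^esub> E n"
    and f_T': "\<forall>\<^sub>F n in U. f (\<lambda>n. T n \<otimes>\<^bsub>G\<^esub> z [^]\<^bsub>G\<^esub> (- E n)) n = T n"
    by (rule exists_central_automorphism) (rule that[unfolded T_def])
  interpret A: ultra_automorphism U ?A f by (rule f)
  interpret A: interpreted_automorphism U ?A f ?B \<Delta> qs \<nu>
    by unfold_locales (use f_const \<Delta> univ in auto)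
  interpret \<tau>: int_automorphism U A.induced
    unfolding int_automorphism_def by (rule A.ultra_automorphism_induced)

  \<comment> \<open>The code \<open>a\<close> as a tuple over the ultrapower; \<open>L\<close> below
    is its preimage under the induced automorphism \<tau>.\<close>
  define K where "K = map (\<lambda>i n. as n ! i) [0..<dim \<Gamma>]"
  have K: "slice n K = as n" "length K = dim \<Gamma>" for n
  proof -
    have "length (as n) = dim \<Gamma>"
      using as(1) by (simp add: code_dom_def tuples_def)
    then show "slice n K = as n" "length K = dim \<Gamma>"
      by (auto simp: K_def slice_def intro: nth_equalityI)
  qed
  obtain l where l: "\<And>k. \<forall>\<^sub>F n in U. A.induced (l k) n = k n"
    using A.induced_surj by metis
  define L where "L = map l K"
  have "\<forall>\<^sub>F n in U. \<forall>k\<in>set K. A.induced (l k) n = k n"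
    using l by (intro eventually_ball_finite) auto
  then have L: "\<forall>\<^sub>F n in U. slice n (map A.induced L) = as n"
    by eventually_elim (simp add: L_def slice_def flip: K(1))

  \<comment> \<open>The image of \<open>L\<close> under \<tau> codes g, the image under
    \<open>f\<close> of g e^(-1); by the definable isomorphism \<open>L\<close> itself codes g
    e^(-1), so it is larger than \<open>a\<close>.\<close>
  have "\<forall>\<^sub>F n in U. slice n (map A.induced L) \<in> code_dom ?B \<Gamma> ps \<and>
      f (\<lambda>n. T n \<otimes>\<^bsub>G\<^esub> z [^]\<^bsub>G\<^esub> (- E n)) n = \<mu> (slice n (map A.induced L))"
    using L f_T' by eventually_elim (simp add: as)
  then have "\<forall>\<^sub>F n in U. slice n L \<in> code_dom ?B \<Gamma> ps \<and>
      T n \<otimes>\<^bsub>G\<^esub> z [^]\<^bsub>G\<^esub> (- E n) = \<mu> (slice n L)"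
    using T zc K(2) by (subst (asm) A.self_iso_transfer[OF def]) (auto simp: L_def univ)
  then have "\<forall>\<^sub>F n in U. sq (slice n K) < sq (slice n L)"
    by eventually_elim (metis K(1) larger)
  \<comment> \<open>Since \<tau> preserves order and commutes with the size, \<tau> a is smaller
    than \<tau> L = a.\<close>
  then have "\<forall>\<^sub>F n in U. A.induced (\<lambda>n. sq (slice n K)) n < A.induced (\<lambda>n. sq (slice n L)) n"
    by (rule \<tau>.f_less)
  with \<tau>.f_sum_squares[of K] \<tau>.f_sum_squares[of L] L
  have less: "\<forall>\<^sub>F n in U. sq (slice n (map A.induced K)) < sq (as n)"
    unfolding sq_def by eventually_elim simp

  \<comment> \<open>Conversely, \<open>a\<close> codes g, so \<tau> a codes g e and must be larger
    than \<open>a\<close>.\<close>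
  have "\<forall>\<^sub>F n in U. slice n K \<in> code_dom ?B \<Gamma> ps \<and> T n = \<mu> (slice n K)"
    by (simp add: K(1) as)
  then have "\<forall>\<^sub>F n in U. slice n (map A.induced K) \<in> code_dom ?B \<Gamma> ps \<and>
      f T n = \<mu> (slice n (map A.induced K))"
    using T K(2) by (subst A.self_iso_transfer[OF def]) (auto simp: univ)
  with f_T have "\<forall>\<^sub>F n in U. sq (as n) < sq (slice n (map A.induced K))"
    by eventually_elim (metis larger)
  with less have "\<forall>\<^sub>F n in U. False"
    by eventually_elim simp
  then show False
    using proper by (simp add: trivial_limit_def)
qed

end
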